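(* Let $\ell\ge1$, let $M(1)$ be the Heisenberg vertex operator algebra of rank $\ell$, and let $\bm{\lambda}$ be a Whittaker function. Let $G$ be any finite subgroup of $O(\ell)$ such that $g\circ\bm{\lambda}\neq\bm{\lambda}$ for all $g\in G$ with $g\ne 1$. Then the Whittaker module $M(1,\bm{\lambda})$ is an irreducible $M(1)^G$-module.
   Context: Let $\mathfrak{h}$ be a complex $\ell$-dimensional vector space with a non-degenerate symmetric bilinear form $(\cdot,\cdot)$, viewed as a commutative Lie algebra, and let $\hat{\mathfrak{h}}=\mathfrak{h}\otimes\mathbb{C}[t,t^{-1}]\oplus\mathbb{C}K$ be the associated Heisenberg Lie algebra: with $a(n)=a\otimes t^n$, $[a(m),b(n)]=m(a,b)\delta_{m+n,0}K$, $K$ central. $M(1)$ is the Heisenberg vertex operator algebra of level $1$ ($K=1$) associated to $\hat{\mathfrak{h}}$. The orthogonal group $O(\ell)=O(\mathfrak{h},(\cdot,\cdot))$ acts on $M(1)$ by automorphisms (extending its action on $\mathfrak{h}$), and $M(1)^G$ is the subalgebra of $G$-fixed points. Let $\mathfrak{n}=\mathfrak{h}\otimes\mathbb{C}[t]$. A Whittaker function is $\bm{\lambda}\in\mathfrak{n}^*$ such that for each $a\in\mathfrak{h}$, $\bm{\lambda}(a(n))=0$ for $n$ sufficiently large. $M(1,\bm{\lambda})$ is the standard Whittaker $\hat{\mathfrak{h}}$-module of level $1$, i.e. $U(\hat{\mathfrak{h}})\otimes_{U(\mathfrak{n}\oplus\mathbb{C}K)}\mathbb{C}w$ with $xw=\bm{\lambda}(x)w$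 for $x\in\mathfrak{n}$ and $Kw=w$; it is a weak $M(1)$-module. For $g\in O(\ell)$, $g\circ\bm{\lambda}$ is defined by $(g\circ\bm{\lambda})(a(n))=\bm{\lambda}((g^{-1}a)(n))$, so that $g\circ M(1,\bm{\lambda})=M(1,g\circ\bm{\lambda})$, where $g\circ M$ is $M$ as a vector space with $Y_{g\circ M}(v,z)=Y_M(g^{-1}v,z)$. Irreducible as an $M(1)^G$-module means nonzero with no nonzero proper subspace stable under all modes $v_n$, $v\in M(1)^G$. *)

theory Defs
  imports Complex_Main "HOL-Library.Poly_Mapping" "HOL-Library.Product_Plus"
    "HOL-Algebra.Group"
begin

text \<open>
  Throughout, \<open>'k \<Rightarrow>\<^sub>0 'h\<close> with \<open>'k = int\<close> and \<open>'k = nat\<close> models \<open>\<hh> \<otimes> \<complex>[t, t\<^sup>-\<^sup>1]\<close> and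
  \<open>\<hh> \<otimes> \<complex>[t]\<close>; \<open>Poly_Mapping.single n a\<close> is \<open>a(n) = a \<otimes> t\<^sup>n\<close>. The Heisenberg Lie algebra
  has \<open>(x, c)\<close> standing for \<open>x + c K\<close>.
\<close>

type_synonym 'h heis = "(int \<Rightarrow>\<^sub>0 'h) \<times> complex"

text \<open>
  The free associative algebra on the underlying set of the Heisenberg Lie algebra: formal linear
  combinations of words. Its product (concatenation) is only needed on words.
\<close>

type_synonym 'h free_alg = "'h heis list \<Rightarrow>\<^sub>0 complex"

definition free_scale :: "complex \<Rightarrow> ('w \<Rightarrow>\<^sub>0 complex) \<Rightarrow> ('w \<Rightarrow>\<^sub>0 complex)" where
  "free_scale c p = Poly_Mapping.map ((*) c) p"

lemma vector_space_free_scale: "vector_space free_scale"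
proof -
  have "Poly_Mapping.lookup (free_scale c p) w = c * Poly_Mapping.lookup p w"
    for c and p :: "'w \<Rightarrow>\<^sub>0 complex" and w
    by (simp add: free_scale_def Poly_Mapping.map.rep_eq when_def)
  note lookup_free_scale = this
  show ?thesis
    by unfold_locales
      (auto intro!: poly_mapping_eqI simp: lookup_free_scale lookup_add algebra_simps)
qed

definition push_words :: "('v \<Rightarrow> 'w) \<Rightarrow> ('v \<Rightarrow>\<^sub>0 complex) \<Rightarrow> ('w \<Rightarrow>\<^sub>0 complex)" where
  "push_words f p = (\<Sum>w\<in>Poly_Mapping.keys p. Poly_Mapping.single (f w) (Poly_Mapping.lookup p w))"

definition central :: "'h::zero heis" where
  "central = (0, 1)"

definition h_mode :: "'h::zero \<Rightarrow> int \<Rightarrow> 'h heis" where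
  "h_mode a n = (Poly_Mapping.single n a, 0)"

definition of_nonneg :: "(nat \<Rightarrow>\<^sub>0 'h::ab_group_add) \<Rightarrow> 'h heis" where
  "of_nonneg x =
     ((\<Sum>k\<in>Poly_Mapping.keys x. Poly_Mapping.single (int k) (Poly_Mapping.lookup x k)), 0)"

definition rep :: "'h::zero free_alg set \<Rightarrow> 'h free_alg" where
  "rep X = (SOME p. p \<in> X)"

text \<open>\<open>(g \<circ> lam)(a(n)) = lam((g\<^sup>-\<^sup>1 a)(n))\<close>, extended linearly.\<close>

definition function_act ::
  "('h::zero \<Rightarrow> 'h) \<Rightarrow> ((nat \<Rightarrow>\<^sub>0 'h) \<Rightarrow> complex) \<Rightarrow> (nat \<Rightarrow>\<^sub>0 'h) \<Rightarrow> complex" where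
  "function_act g lam x = lam (Poly_Mapping.map (inv_into UNIV g) x)"

text \<open>
  The dimension is not part of the locale. In the library, \<open>dim\<close> of an infinite-dimensional space
  is \<open>0\<close>, so \<open>dim UNIV = l\<close> with \<open>l \<ge> 1\<close> includes finite-dimensionality.
\<close>

locale heisenberg_space = vector_space scale
  for scale :: "complex \<Rightarrow> 'h::ab_group_add \<Rightarrow> 'h" +
  fixes form :: "'h \<Rightarrow> 'h \<Rightarrow> complex"
  assumes form_linear: "\<And>x. Vector_Spaces.linear scale (*) (form x)"
    and form_symmetric: "\<And>x y. form x y = form y x"
    and form_nondegenerate: "\<And>x. (\<And>y. form x y = 0) \<Longrightarrow> x = 0"
begin

definition loop_scale :: "complex \<Rightarrow> ('k \<Rightarrow>\<^sub>0 'h) \<Rightarrow> ('k \<Rightarrow>\<^sub>0 'h)" where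
  "loop_scale c x = Poly_Mapping.map (scale c) x"

definition heis_scale :: "complex \<Rightarrow> 'h heis \<Rightarrow> 'h heis" where
  "heis_scale c x = (loop_scale c (fst x), c * snd x)"

text \<open>\<open>[a(m), b(n)] = m (a, b) \<delta>\<^bsub>m+n,0\<^esub> K\<close>, extended bilinearly.\<close>

definition bracket :: "'h heis \<Rightarrow> 'h heis \<Rightarrow> 'h heis" where
  "bracket x y =
     (0, \<Sum>m\<in>Poly_Mapping.keys (fst x).
           of_int m * form (Poly_Mapping.lookup (fst x) m) (Poly_Mapping.lookup (fst y) (- m)))"

definition whittaker_function :: "((nat \<Rightarrow>\<^sub>0 'h) \<Rightarrow> complex) \<Rightarrow> bool" where
  "whittaker_function lam \<longleftrightarrow>
     Vector_Spaces.linear loop_scale (*) lam \<and>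
     (\<forall>a. \<exists>N. \<forall>n\<ge>N. lam (Poly_Mapping.single n a) = 0)"

subsection \<open>The modules \<open>M(1, lam)\<close>\<close>

text \<open>
  The universal enveloping algebra is the free algebra modulo the two-sided ideal spanned by
  \<open>env_relations\<close>. Inducing the character \<open>x \<mapsto> lam(x), K \<mapsto> 1\<close> of \<open>U(\<nn> \<oplus> \<complex>K)\<close> amounts to dividing
  further by the left ideal generated by the elements \<open>x - lam(x)\<close> and \<open>K - 1\<close>.
\<close>

definition env_relations :: "'h free_alg set" where
  "env_relations =
     {Poly_Mapping.single (u @ [x + y] @ v) 1
        - Poly_Mapping.single (u @ [x] @ v) 1 - Poly_Mapping.single (u @ [y] @ v) 1 | u v x y. True}
     \<union> {Poly_Mapping.single (u @ [heis_scale c x] @ v) 1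
          - Poly_Mapping.single (u @ [x] @ v) c | u v c x. True}
     \<union> {Poly_Mapping.single (u @ [x, y] @ v) 1 - Poly_Mapping.single (u @ [y, x] @ v) 1
          - Poly_Mapping.single (u @ [bracket x y] @ v) 1 | u v x y. True}"

definition whittaker_relations :: "((nat \<Rightarrow>\<^sub>0 'h) \<Rightarrow> complex) \<Rightarrow> 'h free_alg set" where
  "whittaker_relations lam =
     {Poly_Mapping.single (u @ [of_nonneg x]) 1 - Poly_Mapping.single u (lam x) | u x. True}
     \<union> {Poly_Mapping.single (u @ [central]) 1 - Poly_Mapping.single u 1 | u. True}"

definition whittaker_kernel :: "((nat \<Rightarrow>\<^sub>0 'h) \<Rightarrow> complex) \<Rightarrow> 'h free_alg set" where
  "whittaker_kernel lam = module.span free_scale (env_relations \<union> whittaker_relations lam)"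

text \<open>
  \<open>cls lam p\<close> is the vector \<open>p w\<close> of \<open>M(1, lam)\<close>, as a coset. Operations on cosets are computed on
  representatives.
\<close>

definition cls :: "((nat \<Rightarrow>\<^sub>0 'h) \<Rightarrow> complex) \<Rightarrow> 'h free_alg \<Rightarrow> 'h free_alg set" where
  "cls lam p = {q. q - p \<in> whittaker_kernel lam}"

definition whittaker_module :: "((nat \<Rightarrow>\<^sub>0 'h) \<Rightarrow> complex) \<Rightarrow> 'h free_alg set set" where
  "whittaker_module lam = range (cls lam)"

definition wzero :: "((nat \<Rightarrow>\<^sub>0 'h) \<Rightarrow> complex) \<Rightarrow> 'h free_alg set" where
  "wzero lam = cls lam 0"

definition wadd ::
  "((nat \<Rightarrow>\<^sub>0 'h) \<Rightarrow> complex) \<Rightarrow> 'h free_alg set \<Rightarrow> 'h free_alg set \<Rightarrow> 'h free_alg set" where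
  "wadd lam X Y = cls lam (rep X + rep Y)"

definition wscale ::
  "((nat \<Rightarrow>\<^sub>0 'h) \<Rightarrow> complex) \<Rightarrow> complex \<Rightarrow> 'h free_alg set \<Rightarrow> 'h free_alg set" where
  "wscale lam c X = cls lam (free_scale c (rep X))"

text \<open>The sum of a family of vectors all but finitely many of which vanish (junk otherwise).\<close>

definition wsum ::
  "((nat \<Rightarrow>\<^sub>0 'h) \<Rightarrow> complex) \<Rightarrow> ('i \<Rightarrow> 'h free_alg set) \<Rightarrow> 'h free_alg set" where
  "wsum lam X = cls lam (\<Sum>i\<in>{i. X i \<noteq> wzero lam}. rep (X i))"

definition wact ::
  "((nat \<Rightarrow>\<^sub>0 'h) \<Rightarrow> complex) \<Rightarrow> 'h heis \<Rightarrow> 'h free_alg set \<Rightarrow> 'h free_alg set" where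
  "wact lam x X = cls lam (push_words ((#) x) (rep X))"

subsection \<open>The vertex algebra \<open>M(1)\<close> and its action\<close>

text \<open>\<open>M(1) = M(1, 0)\<close>, with the class of the empty word as vacuum.\<close>

abbreviation zero_function :: "(nat \<Rightarrow>\<^sub>0 'h) \<Rightarrow> complex" where
  "zero_function \<equiv> \<lambda>_. 0"

definition heisenberg_voa :: "'h free_alg set set" where
  "heisenberg_voa = whittaker_module zero_function"

text \<open>
  The list \<open>[(a\<^sub>1, n\<^sub>1), \<dots>, (a\<^sub>r, n\<^sub>r)]\<close> stands for \<open>a\<^sub>1(-n\<^sub>1-1) \<cdots> a\<^sub>r(-n\<^sub>r-1) 1\<close>, whose vertex operator
  is the normally ordered product of the fields
  \<open>(1/n!) \<partial>\<^sup>n a(z) = \<Sum>\<^sub>k (-k-1 choose n) a(k) z\<^bsup>-k-n-1\<^esup>\<close>, where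
  \<open>:A(z) B(z): = A\<^sub>-(z) B(z) + B(z) A\<^sub>+(z)\<close> with \<open>A\<^sub>-\<close> the part of \<open>A\<close> involving \<open>a(k)\<close> for \<open>k < 0\<close>
  and \<open>A\<^sub>+\<close> the rest. \<open>normal_mode lam as m\<close> is the coefficient of \<open>z\<^bsup>-m-1\<^esup>\<close> as an operator on
  \<open>M(1, lam)\<close>. On each vector only finitely many terms of the sum over \<open>k\<close> are nonzero.
\<close>

primrec normal_mode ::
  "((nat \<Rightarrow>\<^sub>0 'h) \<Rightarrow> complex) \<Rightarrow> ('h \<times> nat) list \<Rightarrow> int \<Rightarrow> 'h free_alg set \<Rightarrow> 'h free_alg set" where
  "normal_mode lam [] = (\<lambda>m X. if m = - 1 then X else wzero lam)"
| "normal_mode lam (b # bs) = (\<lambda>m X. case b of (a, n) \<Rightarrow>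
     wsum lam (\<lambda>k::int. wscale lam (of_int (- k - 1) gchoose n)
       (if k < 0
        then wact lam (h_mode a k) (normal_mode lam bs (m - k - int n - 1) X)
        else normal_mode lam bs (m - k - int n - 1) (wact lam (h_mode a k) X))))"

definition creation :: "(('h \<times> nat) list \<Rightarrow>\<^sub>0 complex) \<Rightarrow> 'h free_alg" where
  "creation p = push_words (map (\<lambda>(a, n). h_mode a (- int n - 1))) p"

text \<open>
  \<open>vertex_mode lam v m\<close> is the mode \<open>v\<^sub>m\<close> on \<open>M(1, lam)\<close>: write \<open>v\<close> as a combination of monomials
  \<open>a\<^sub>1(-n\<^sub>1-1) \<cdots> a\<^sub>r(-n\<^sub>r-1) 1\<close>, which span \<open>M(1)\<close>, and extend \<open>normal_mode\<close> linearly. The result does not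
  depend on the expression chosen for \<open>v\<close>: all linear relations between these monomials come from
  linearity in the \<open>a\<^sub>i\<close> and from permuting the factors, and normally ordered products respect both.
\<close>

definition vertex_mode ::
  "((nat \<Rightarrow>\<^sub>0 'h) \<Rightarrow> complex) \<Rightarrow> 'h free_alg set \<Rightarrow> int \<Rightarrow> 'h free_alg set \<Rightarrow> 'h free_alg set" where
  "vertex_mode lam v m X =
     (let p = (SOME p. cls zero_function (creation p) = v)
      in wsum lam (\<lambda>w. wscale lam (Poly_Mapping.lookup p w) (normal_mode lam w m X)))"

subsection \<open>The orthogonal group\<close>

definition orthogonal_group :: "('h \<Rightarrow> 'h) monoid" where
  "orthogonal_group =
     \<lparr>carrier = {g. Vector_Spaces.linear scale scale g \<and> bij g \<and>
                    (\<forall>x y. form (g x) (g y) = form x y)},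
      mult = (\<circ>), one = id\<rparr>"

text \<open>\<open>g (a\<^sub>1(n\<^sub>1) \<cdots> a\<^sub>r(n\<^sub>r) 1) = (g a\<^sub>1)(n\<^sub>1) \<cdots> (g a\<^sub>r)(n\<^sub>r) 1\<close>\<close>

definition voa_act :: "('h \<Rightarrow> 'h) \<Rightarrow> 'h free_alg set \<Rightarrow> 'h free_alg set" where
  "voa_act g v =
     cls zero_function (push_words (map (\<lambda>(x, c). (Poly_Mapping.map g x, c))) (rep v))"

definition voa_fixed_points :: "('h \<Rightarrow> 'h) set \<Rightarrow> 'h free_alg set set" where
  "voa_fixed_points G = {v \<in> heisenberg_voa. \<forall>g\<in>G. voa_act g v = v}"

subsection \<open>Irreducibility\<close>

definition wsubspace :: "((nat \<Rightarrow>\<^sub>0 'h) \<Rightarrow> complex) \<Rightarrow> 'h free_alg set set \<Rightarrow> bool" where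
  "wsubspace lam S \<longleftrightarrow>
     S \<subseteq> whittaker_module lam \<and> wzero lam \<in> S \<and>
     (\<forall>X\<in>S. \<forall>Y\<in>S. wadd lam X Y \<in> S) \<and> (\<forall>c. \<forall>X\<in>S. wscale lam c X \<in> S)"

text \<open>\<open>M(1, lam)\<close> is irreducible under the modes of the elements of \<open>U \<subseteq> M(1)\<close>.\<close>

definition irreducible_whittaker_module ::
  "'h free_alg set set \<Rightarrow> ((nat \<Rightarrow>\<^sub>0 'h) \<Rightarrow> complex) \<Rightarrow> bool" where
  "irreducible_whittaker_module U lam \<longleftrightarrow>
     whittaker_module lam \<noteq> {wzero lam} \<and>
     (\<forall>S. wsubspace lam S \<and> (\<forall>v\<in>U. \<forall>m. \<forall>X\<in>S. vertex_mode lam v m X \<in> S)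
          \<longrightarrow> S = {wzero lam} \<or> S = whittaker_module lam)"

end

end

theory Submission
  imports Defs
begin

text \<open>
  Let \<open>M = M(1, lam)\<close>, let \<open>v\<close> be a nonzero vector of an \<open>M(1)\<^sup>G\<close>-submodule \<open>S\<close>, and consider the
  direct sum of the modules \<open>M\<close> twisted by \<open>g \<in> G\<close>, on which \<open>a(k)\<close> acts as \<open>(g a)(k)\<close> in the
  component \<open>g\<close>. The diagonal vector \<open>(v, \<dots>, v)\<close> generates the component at the identity as soon as
  the twists are irreducible and pairwise different: the operators \<open>a(n)\<close> with \<open>n \<ge> 0\<close> commute and have
  one generalised eigenvalue in each component, given by a translate of \<open>lam\<close>, and the hypothesis
  says that the eigenvalue at the identity is distinguished from all the others. Polynomials in the
  \<open>a(n)\<close> therefore cut out the component at the identity, where irreducibility of \<open>M\<close> over the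
  Heisenberg algebra applies. Hence for every \<open>u \<in> M\<close> there is a combination of words in the modes
  whose value on \<open>v\<close> is \<open>u\<close> in the component at the identity and \<open>0\<close> in the others. Summing the
  twists of this combination over \<open>G\<close> again gives \<open>u\<close>. This is \<open>twisted_sums_generate\<close>; it rests on
  \<open>W_irreducible\<close>, which is proved with locally nilpotent derivations and an Euler operator.

  It remains to see that sums over \<open>G\<close> of twisted words belong to \<open>S\<close>. By invariance of the form,
  words can be reordered into normally ordered words uniformly in the twist. A mode of a normally
  ordered product of derivatives of fields is, on a given vector, a finite combination of normally
  ordered words whose coefficients are products of binomial coefficients in the indices. Since these
  coefficients span the polynomials in each index, \<open>interpolation\<close> over the orders of the derivatives
  isolates every single normally ordered word. Averaging over \<open>G\<close>, each sum over \<open>G\<close> of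
  twisted normally ordered words lies in the span of the modes of averaged monomials applied to
  \<open>v\<close>, and averaged monomials are fixed points (\<open>twisted_modes_generate\<close>, \<open>averaged_word_fixed\<close>).

  The module is a quotient of a free algebra, and one needs to know that its vacuum is nonzero and
  that the mode of a state does not depend on how the state is written in monomials. Both follow
  from the transposed Heisenberg action on symmetric multilinear functionals (\<open>dual_eval_kernel\<close>). The
  computations in the quotient are carried out on normal forms, with respect to a projection of
  the free algebra along the relations.
\<close>

section \<open>Linear algebra of the bilinear form\<close>

context heisenberg_space
begin

lemma form_add_right: "form x (y + z) = form x y + form x z"
  and form_scale_right: "form x (scale c y) = c * form x y"
  using form_linear[of x] by (simp_all add: Vector_Spaces.linear_iff)

lemma form_add_left: "form (x + y) z = form x z + form y z"
  and form_scale_left: "form (scale c x) z = c * form x z"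
  using form_add_right form_scale_right by (simp_all add: form_symmetric[of _ z])

lemma form_zero_left [simp]: "form 0 x = 0" and form_zero_right [simp]: "form x 0 = 0"
  using form_scale_right[of x 0 0] form_scale_left[of 0 0 x] by simp_all

text \<open>
  The map \<open>a \<mapsto> \<Sum>b\<in>B. (a, b) b\<close> is injective because the form is nondegenerate, hence bijective
  because \<open>B\<close> is finite. Preimages of the basis vectors form the dual basis.
\<close>

lemma dual_basis_exists:
  assumes fin: "finite B" and ind: "independent B" and sp: "span B = UNIV"
  obtains dual where "\<And>x. x = (\<Sum>b\<in>B. scale (form (dual b) x) b)"
proof -
  interpret fd: finite_dimensional_vector_space scale B
    using fin ind sp by unfold_locales auto
  define f where "f a = (\<Sum>b\<in>B. scale (form a b) b)" for a
  have lin: "Vector_Spaces.linear scale scale f"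
    unfolding Vector_Spaces.linear_iff
    by (auto simp: vector_space_axioms f_def form_add_left form_scale_left scale_left_distrib
        sum.distrib scale_sum_right)
  have "a = 0" if "f a = 0" for a
  proof (rule form_nondegenerate)
    fix y
    have ab: "form a b = 0" if "b \<in> B" for b
      using \<open>f a = 0\<close> unfolding f_def by (rule independentD[OF ind fin subset_refl]) (rule that)
    have "y \<in> span B" by (simp add: sp)
    then show "form a y = 0"
      by (induction rule: span_induct_alt) (simp_all add: ab form_add_right form_scale_right)
  qed
  then have "inj f"
    using lin by (intro injI) (metis eq_iff_diff_eq_0 Vector_Spaces.linear.axioms(3) module_hom.diff)
  then have "surj f"
    using lin fd.linear_inj_imp_surj by blast
  then have "\<forall>b. \<exists>a. f a = b" by (metis surjD)
  then obtain dual where dual: "\<And>b. f (dual b) = b" by metis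
  have dual_form: "form (dual b) c = (if c = b then 1 else 0)" if "b \<in> B" "c \<in> B" for b c
  proof -
    have "(\<Sum>c\<in>B. scale (if c = b then 1 else 0) c) = (\<Sum>c\<in>B. if c = b then b else 0)"
      by (intro sum.cong) auto
    also have "\<dots> = b" using fin that by simp
    finally have "(\<Sum>c\<in>B. scale (form (dual b) c - (if c = b then 1 else 0)) c) = 0"
      using dual[of b, unfolded f_def] by (simp add: scale_left_diff_distrib sum_subtractf)
    then have "form (dual b) c - (if c = b then 1 else 0) = 0"
      by (rule independentD[OF ind fin subset_refl]) (rule that)
    then show ?thesis by simp
  qed
  show thesis
  proof
    fix x
    have "x \<in> span B" by (simp add: sp)
    then show "x = (\<Sum>b\<in>B. scale (form (dual b) x) b)"
    proof (induction rule: span_induct_alt)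
      case base
      show ?case by simp
    next
      case (step c x y)
      have "(\<Sum>b\<in>B. scale (form (dual b) (scale c x + y)) b)
          = (\<Sum>b\<in>B. scale (c * form (dual b) x) b) + (\<Sum>b\<in>B. scale (form (dual b) y) b)"
        by (simp add: form_add_right form_scale_right scale_left_distrib sum.distrib)
      also have "(\<Sum>b\<in>B. scale (c * form (dual b) x) b) = scale c x"
      proof -
        have "(\<Sum>b\<in>B. scale (c * form (dual b) x) b) = (\<Sum>b\<in>B. if b = x then scale c x else 0)"
          using step(1) by (intro sum.cong) (auto simp: dual_form)
        then show ?thesis using step(1) fin by simp
      qed
      finally show ?case using step(2) by simp
    qed
  qed
qed

end

section \<open>Whittaker modules as spaces with Heisenberg operators\<close>

text \<open>
  The operators \<open>A a k\<close> are the modes \<open>a(k)\<close>, and \<open>mu a n\<close> is the eigenvalue of \<open>a(n)\<close>, for \<open>n \<ge> 0\<close>, on the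
  Whittaker vector \<open>vac\<close>. The module is a subspace \<open>W\<close> of the type rather than the whole type, since it
  will be realised as the range of a projection of the free algebra. Cyclicity is stated as an
  induction principle.
\<close>

locale whittaker_operators = heisenberg_space scale form + V: vector_space sv
  for scale :: "complex \<Rightarrow> 'h::ab_group_add \<Rightarrow> 'h"
    and form :: "'h \<Rightarrow> 'h \<Rightarrow> complex"
    and sv :: "complex \<Rightarrow> 'v::ab_group_add \<Rightarrow> 'v" (infixr "*v" 75) +
  fixes W :: "'v set"
    and A :: "'h \<Rightarrow> int \<Rightarrow> 'v \<Rightarrow> 'v"
    and vac :: 'v
    and mu :: "'h \<Rightarrow> nat \<Rightarrow> complex"
    and B :: "'h set"
  assumes basis: "finite B" "independent B" "span B = UNIV"
    and A_add: "A a k (v + w) = A a k v + A a k w"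
    and A_scale: "A a k (c *v v) = c *v A a k v"
    and A_add_left: "A (a + b) k v = A a k v + A b k v"
    and A_scale_left: "A (scale c a) k v = c *v A a k v"
    and mu_add: "mu (a + b) n = mu a n + mu b n"
    and mu_scale: "mu (scale c a) n = c * mu a n"
    and mu_finite: "\<exists>N. \<forall>n\<ge>N. mu a n = 0"
    and W_subspace: "V.subspace W"
    and A_W: "v \<in> W \<Longrightarrow> A a k v \<in> W"
    and A_commute: "v \<in> W \<Longrightarrow>
      A a j (A b k v) = A b k (A a j v) + (if j + k = 0 then of_int j * form a b else 0) *v v"
    and vac_W: "vac \<in> W"
    and A_vac: "A a (int n) vac = mu a n *v vac"
    and W_generated: "V.subspace S \<Longrightarrow> vac \<in> S \<Longrightarrow>
      (\<And>a k v. v \<in> S \<Longrightarrow> v \<in> W \<Longrightarrow> A a k v \<in> S) \<Longrightarrow> W \<subseteq> S"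
begin

lemma A_zero [simp]: "A a k 0 = 0"
  using A_scale[of a k 0 0] by simp

lemma A_zero_left [simp]: "A 0 k v = 0"
  using A_scale_left[of 0 0 k v] by simp

lemma A_sum: "A a k (sum f I) = (\<Sum>i\<in>I. A a k (f i))"
  by (induction I rule: infinite_finite_induct) (simp_all add: A_add)

lemma A_diff: "A a k (v - w) = A a k v - A a k w"
  using A_add[of a k v "(- 1) *v w"] A_scale[of a k "- 1" w] by simp

lemma A_sum_left: "A (sum f I) k v = (\<Sum>i\<in>I. A (f i) k v)"
  by (induction I rule: infinite_finite_induct) (simp_all add: A_add_left)

lemma mu_zero [simp]: "mu 0 n = 0"
  using mu_scale[of 0 0 n] by simp

lemma basis_induct:
  assumes "\<And>b. b \<in> B \<Longrightarrow> P b" "P 0" "\<And>a b. P a \<Longrightarrow> P b \<Longrightarrow> P (a + b)"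
    "\<And>c a. P a \<Longrightarrow> P (scale c a)"
  shows "P a"
proof -
  have "a \<in> span B" by (simp add: basis)
  then show ?thesis
    by (induction rule: span_induct_alt) (use assms in auto)
qed

lemma W_induct [consumes 1, case_names zero add scale vac act]:
  assumes "v \<in> W" and "P 0" and "\<And>v w. v \<in> W \<Longrightarrow> w \<in> W \<Longrightarrow> P v \<Longrightarrow> P w \<Longrightarrow> P (v + w)"
    and "\<And>c v. v \<in> W \<Longrightarrow> P v \<Longrightarrow> P (c *v v)" and "P vac"
    and "\<And>a k v. v \<in> W \<Longrightarrow> P v \<Longrightarrow> P (A a k v)"
  shows "P v"
proof -
  have "W \<subseteq> {v \<in> W. P v}"
    using assms W_subspace A_W vac_W
    by (intro W_generated V.subspaceI)
       (auto intro: V.subspace_0 V.subspace_add V.subspace_scale)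
  then show ?thesis using assms(1) by blast
qed

subsection \<open>The annihilation operators are locally nilpotent up to a scalar\<close>

lemma mu_vanishes: "\<exists>N. \<forall>a. \<forall>n\<ge>N. mu a n = 0"
proof -
  obtain N where N: "\<And>b n. n \<ge> N b \<Longrightarrow> mu b n = 0" using mu_finite by metis
  have "mu a n = 0" if "n \<ge> Max (insert 0 (N ` B))" for a n
  proof (induction a rule: basis_induct)
    case (1 b)
    then have "N b \<le> Max (insert 0 (N ` B))" using basis by (intro Max_ge) auto
    then show ?case using N that by simp
  qed (simp_all add: mu_add mu_scale)
  then show ?thesis by blast
qed

lemma A_bounded:
  assumes "v \<in> W"
  shows "\<exists>N\<ge>1. \<forall>a. \<forall>k\<ge>int N. A a k v = 0"
  using assms
proof (induction rule: W_induct)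
  case (add v w)
  then obtain N M where "N \<ge> 1" "\<forall>a. \<forall>k\<ge>int N. A a k v = 0" "\<forall>a. \<forall>k\<ge>int M. A a k w = 0"
    by blast
  then show ?case by (intro exI[of _ "max N M"]) (auto simp: A_add)
next
  case (scale c v)
  then show ?case by (auto simp: A_scale)
next
  case vac
  obtain N where N: "\<And>a n. n \<ge> N \<Longrightarrow> mu a n = 0" using mu_vanishes by blast
  have "A a k vac = 0" if "k \<ge> int (Suc N)" for a k
    using A_vac[of a "nat k"] N[of "nat k" a] that by simp
  then show ?case by (intro exI[of _ "Suc N"]) auto
next
  case (act a k v)
  then obtain N where N: "N \<ge> 1" "\<forall>a. \<forall>k\<ge>int N. A a k v = 0" by blast
  have "A b j (A a k v) = 0" if "j \<ge> int (N + nat \<bar>k\<bar> + 1)" for b j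
  proof -
    have "j + k \<noteq> 0" using that by linarith
    then show ?thesis using A_commute[OF act(1), of b j a k] N(2) that by simp
  qed
  then show ?case by (intro exI[of _ "N + nat \<bar>k\<bar> + 1"]) auto
qed auto

text \<open>
  In the polynomial picture of the module, \<open>a(n)\<close> for \<open>n > 0\<close> is a constant plus a derivation. The
  operator \<open>ann a n\<close> is that derivation.
\<close>

definition ann :: "'h \<Rightarrow> nat \<Rightarrow> 'v \<Rightarrow> 'v" where
  "ann a n v = A a (int n) v - mu a n *v v"

lemma ann_add: "ann a n (v + w) = ann a n v + ann a n w"
  by (simp add: ann_def A_add algebra_simps)

lemma ann_scale: "ann a n (c *v v) = c *v ann a n v"
  by (simp add: ann_def A_scale algebra_simps)

lemma ann_zero [simp]: "ann a n 0 = 0"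
  by (simp add: ann_def)

lemma ann_vac [simp]: "ann a n vac = 0"
  by (simp add: ann_def A_vac)

lemma ann_W: "v \<in> W \<Longrightarrow> ann a n v \<in> W"
  by (simp add: ann_def A_W W_subspace V.subspace_diff V.subspace_scale)

lemma ann_pow_W: "v \<in> W \<Longrightarrow> (ann a n ^^ j) v \<in> W"
  by (induction j) (simp_all add: ann_W)

lemma ann_pow_zero [simp]: "(ann a n ^^ j) 0 = 0"
  by (induction j) simp_all

lemma ann_pow_add: "(ann a n ^^ j) (v + w) = (ann a n ^^ j) v + (ann a n ^^ j) w"
  by (induction j) (simp_all add: ann_add)

lemma ann_pow_scale: "(ann a n ^^ j) (c *v v) = c *v (ann a n ^^ j) v"
  by (induction j) (simp_all add: ann_scale)

lemma ann_A:
  fixes k :: int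
  assumes "v \<in> W"
  shows "ann a n (A b k v)
    = A b k (ann a n v) + (if int n + k = 0 then of_nat n * form a b else 0) *v v"
  using A_commute[OF assms, of a "int n" b k]
  by (simp add: ann_def A_diff A_scale algebra_simps)

lemma ann_commute:
  assumes "v \<in> W"
  shows "ann a n (ann b m v) = ann b m (ann a n v)"
proof -
  have "ann a n (ann b m v) = ann a n (A b (int m) v) - mu b m *v ann a n v"
    by (simp add: ann_def A_diff A_scale algebra_simps)
  also have "ann a n (A b (int m) v) = A b (int m) (ann a n v)"
    using ann_A[OF assms, of a n b "int m"] by auto
  finally show ?thesis by (simp add: ann_def)
qed

lemma ann_pow_A:
  fixes k :: int
  assumes "v \<in> W"
  shows "(ann a n ^^ Suc j) (A b k v) = A b k ((ann a n ^^ Suc j) v)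
    + (of_nat (Suc j) * (if int n + k = 0 then of_nat n * form a b else 0)) *v (ann a n ^^ j) v"
proof (induction j)
  case 0
  show ?case using ann_A[OF assms, of a n b k] by simp
next
  case (Suc j)
  let ?c = "if int n + k = 0 then of_nat n * form a b else 0"
  have "(ann a n ^^ Suc (Suc j)) (A b k v) = ann a n ((ann a n ^^ Suc j) (A b k v))" by simp
  also have "\<dots> = ann a n (A b k ((ann a n ^^ Suc j) v))
      + (of_nat (Suc j) * ?c) *v (ann a n ^^ Suc j) v"
    unfolding Suc by (simp add: ann_add ann_scale)
  also have "ann a n (A b k ((ann a n ^^ Suc j) v))
      = A b k ((ann a n ^^ Suc (Suc j)) v) + ?c *v (ann a n ^^ Suc j) v"
    by (subst ann_A[OF ann_pow_W[OF assms]]) simp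
  also have "A b k ((ann a n ^^ Suc (Suc j)) v) + ?c *v (ann a n ^^ Suc j) v
      + (of_nat (Suc j) * ?c) *v (ann a n ^^ Suc j) v
      = A b k ((ann a n ^^ Suc (Suc j)) v) + (?c + of_nat (Suc j) * ?c) *v (ann a n ^^ Suc j) v"
    by (simp only: V.scale_left_distrib add.assoc)
  also have "?c + of_nat (Suc j) * ?c = of_nat (Suc (Suc j)) * ?c"
    by (simp add: algebra_simps)
  finally show ?case .
qed

text \<open>
  The commutator of \<open>ann a n\<close> with any mode is a scalar, so applying one more mode to a vector raises
  the order of nilpotency by at most one.
\<close>

lemma ann_locally_nilpotent:
  assumes "v \<in> W"
  shows "\<exists>j. (ann a n ^^ j) v = 0"
  using assms
proof (induction rule: W_induct)
  case (add v w)
  then obtain i j where i: "(ann a n ^^ i) v = 0" and j: "(ann a n ^^ j) w = 0" by blast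
  have "(ann a n ^^ (j + i)) v = 0" "(ann a n ^^ (i + j)) w = 0"
    using i j by (simp_all only: funpow_add o_apply ann_pow_zero)
  then have "(ann a n ^^ (i + j)) (v + w) = 0"
    by (simp add: ann_pow_add add.commute)
  then show ?case by blast
next
  case (scale c v)
  then show ?case by (auto simp: ann_pow_scale)
next
  case vac
  have "(ann a n ^^ 1) vac = 0" by simp
  then show ?case by blast
next
  case (act b k v)
  then obtain j where "(ann a n ^^ j) v = 0" by blast
  then have "(ann a n ^^ Suc j) (A b k v) = 0"
    using ann_pow_A[OF act(1), of j a n b k] by simp
  then show ?case by blast
qed simp

lemma ann_last_power:
  assumes "v \<in> W" "v \<noteq> 0"
  obtains j where "(ann a n ^^ j) v \<noteq> 0" "ann a n ((ann a n ^^ j) v) = 0"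
proof -
  define k where "k = (LEAST j. (ann a n ^^ j) v = 0)"
  have k: "(ann a n ^^ k) v = 0"
    using ann_locally_nilpotent[OF assms(1)] unfolding k_def by (rule LeastI_ex)
  then obtain j where j: "k = Suc j" using assms(2) by (cases k) auto
  have "(ann a n ^^ j) v \<noteq> 0"
    using not_less_Least[of j "\<lambda>j. (ann a n ^^ j) v = 0"] j unfolding k_def by auto
  then show thesis using that k j by simp
qed

lemma ann_bounded:
  assumes "v \<in> W"
  shows "\<exists>N. \<forall>a. \<forall>n\<ge>N. ann a n v = 0"
proof -
  obtain N where "\<forall>a. \<forall>k\<ge>int N. A a k v = 0" using A_bounded[OF assms] by blast
  moreover obtain M where "\<forall>a. \<forall>n\<ge>M. mu a n = 0" using mu_vanishes by blast
  ultimately have "ann a n v = 0" if "n \<ge> max N M" for a n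
    using that by (simp add: ann_def)
  then show ?thesis by blast
qed

lemma ann_add_left: "ann (a + b) n v = ann a n v + ann b n v"
  by (simp add: ann_def A_add_left mu_add V.scale_left_distrib)

lemma ann_scale_left: "ann (scale c a) n v = c *v ann a n v"
  by (simp add: ann_def A_scale_left mu_scale V.scale_right_diff_distrib)

lemma ann_left_zero:
  assumes "\<And>b. b \<in> B \<Longrightarrow> ann b n v = 0"
  shows "ann a n v = 0"
proof (induction a rule: basis_induct)
  case 2
  show ?case by (simp add: ann_def)
qed (simp_all add: assms ann_add_left ann_scale_left)

text \<open>
  All but finitely many of the operators \<open>ann b n\<close>, with \<open>b\<close> in the basis, kill a given vector. The
  remaining ones commute and are locally nilpotent, so the last nonzero power of each of them can be
  taken in turn.
\<close>

lemma exists_common_null_vector: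
  assumes S: "S \<subseteq> W" "V.subspace S" "\<And>a k v. v \<in> S \<Longrightarrow> A a k v \<in> S"
    and v: "v \<in> S" "v \<noteq> 0"
  obtains u where "u \<in> S" "u \<noteq> 0" "\<And>a n. ann a n u = 0"
proof -
  have ann_S: "(ann a n ^^ j) u \<in> S" if "u \<in> S" for a n j u
    using that by (induction j) (simp_all add: ann_def S V.subspace_diff V.subspace_scale)
  obtain N where N: "\<And>a n. n \<ge> N \<Longrightarrow> ann a n v = 0" using ann_bounded v S by blast
  have pow_comm: "ann a n ((ann b m ^^ j) u) = 0" if "u \<in> S" "ann a n u = 0" for a b n m j u
  proof (induction j)
    case (Suc j)
    then show ?case using ann_commute[of "(ann b m ^^ j) u" a n b m] ann_S[OF that(1)] S(1)
      by auto
  qed (simp add: that)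
  have "\<exists>u\<in>S. u \<noteq> 0 \<and> (\<forall>a. \<forall>n\<ge>N. ann a n u = 0) \<and> (\<forall>(b, n)\<in>Q. ann b n u = 0)"
    if "finite Q" for Q
    using that
  proof induction
    case empty
    show ?case using v N by auto
  next
    case (insert q Q)
    obtain b m where q: "q = (b, m)" by force
    obtain u where u: "u \<in> S" "u \<noteq> 0" "\<forall>a. \<forall>n\<ge>N. ann a n u = 0" "\<forall>(b, n)\<in>Q. ann b n u = 0"
      using insert by blast
    obtain j where j: "(ann b m ^^ j) u \<noteq> 0" "ann b m ((ann b m ^^ j) u) = 0"
      using ann_last_power u S(1) by blast
    show ?case
      by (rule bexI[of _ "(ann b m ^^ j) u"]) (use u j q pow_comm ann_S in auto)
  qed
  from this[of "B \<times> {..<N}"] obtain u where u: "u \<in> S" "u \<noteq> 0" "\<forall>a. \<forall>n\<ge>N. ann a n u = 0"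
    "\<forall>(b, n)\<in>B \<times> {..<N}. ann b n u = 0"
    using basis by auto
  have "ann a n u = 0" for a n
    by (rule ann_left_zero) (use u in \<open>auto simp: not_less[symmetric]\<close>)
  then show thesis using that u by blast
qed

subsection \<open>Irreducibility\<close>

definition creation_word :: "('h \<times> nat) list \<Rightarrow> 'v" where
  "creation_word u = foldr (\<lambda>(a, n). A a (- int n - 1)) u vac"

lemma creation_word_simps [simp]: "creation_word [] = vac" "creation_word ((a, n) # u) = A a (- int n - 1) (creation_word u)"
  by (simp_all add: creation_word_def)

lemma creation_word_W: "creation_word u \<in> W"
  by (induction u) (auto simp: vac_W A_W)

lemma W_span_creation_words: "W \<subseteq> V.span (range creation_word)"
proof (rule W_generated)
  have neg: "A a (- int n - 1) v \<in> V.span (range creation_word)" if "v \<in> V.span (range creation_word)" for a n v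
    using that
  proof (induction rule: V.span_induct_alt)
    case (step c x y)
    then obtain u where "x = creation_word u" by blast
    then have "A a (- int n - 1) x \<in> V.span (range creation_word)"
      by (metis V.span_base creation_word_simps(2) rangeI)
    then show ?case using step by (simp add: A_add A_scale V.span_add V.span_scale)
  qed (simp add: V.span_zero)
  have nonneg: "A a (int m) (creation_word u) \<in> V.span (range creation_word)" for a m u
  proof (induction u)
    case Nil
    show ?case by (simp add: A_vac) (metis V.span_base V.span_scale creation_word_simps(1) rangeI)
  next
    case (Cons p u)
    obtain b n where p: "p = (b, n)" by force
    have "creation_word u \<in> V.span (range creation_word)" by (simp add: V.span_base)
    then show ?case using neg[OF Cons] A_commute[OF creation_word_W, of a "int m" b "- int n - 1" u]
      by (simp add: p V.span_add V.span_scale)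
  qed
  show "A a k v \<in> V.span (range creation_word)" if "v \<in> V.span (range creation_word)" for a k v
  proof (cases "k < 0")
    case True
    then show ?thesis using neg[OF that, of a "nat (- k - 1)"] by simp
  next
    case False
    then obtain m where k: "k = int m" by (metis not_less nonneg_int_cases)
    show ?thesis unfolding k using that
      by (induction rule: V.span_induct_alt)
         (auto simp: A_add A_scale V.span_add V.span_scale V.span_zero nonneg)
  qed
qed (auto simp: V.span_base intro!: V.span_base image_eqI[of _ creation_word "[]"])

text \<open>
  A polynomial all of whose derivatives vanish is constant. To avoid choosing coordinates, consider
  the Euler operator \<open>E = \<Sum>\<^sub>n \<Sum>\<^sub>b b(-n) ann b\<^sup>* n\<close>, where \<open>b\<^sup>*\<close> runs through the dual basis. A product of
  creation operators applied to \<open>vac\<close> is an eigenvector whose eigenvalue is its weight, a positive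
  integer unless the product is empty. Hence \<open>(E - 1) (E - 2) \<cdots> (E - D)\<close> maps any vector into the
  line of \<open>vac\<close> for large \<open>D\<close>, while it acts as a nonzero scalar on the kernel of \<open>E\<close>. The sum over
  \<open>n\<close> is cut off at \<open>N\<close>, beyond the modes that occur in the vector.
\<close>

lemma joint_kernel_in_span_vac:
  assumes "v \<in> W" and null: "\<And>a n. ann a n v = 0"
  shows "v \<in> V.span {vac}"
proof -
  obtain dual where dual: "\<And>x. x = (\<Sum>b\<in>B. scale (form (dual b) x) b)"
    using dual_basis_exists basis by blast
  define E where
    "E N v = (\<Sum>n<N. \<Sum>b\<in>B. A b (- int n - 1) (ann (dual b) (Suc n) v))" for N v
  have E_add: "E N (v + w) = E N v + E N w" for N v w
    by (simp add: E_def ann_add A_add sum.distrib)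
  have E_scale: "E N (c *v v) = c *v E N v" for N c v
    by (simp add: E_def ann_scale A_scale V.scale_sum_right)
  have E_zero: "E N 0 = 0" for N by (simp add: E_def)
  have E_creation_word: "E N (creation_word u) = of_nat (\<Sum>(a, n)\<leftarrow>u. Suc n) *v creation_word u"
    if "\<forall>(a, n)\<in>set u. n < N" for N u
    using that
  proof (induction u)
    case Nil
    show ?case by (simp add: E_def)
  next
    case (Cons p u)
    obtain a m where p: "p = (a, m)" by force
    then have m: "m < N" using Cons.prems by simp
    have "E N (A a (- int m - 1) (creation_word u)) = (\<Sum>n<N. \<Sum>b\<in>B.
        A a (- int m - 1) (A b (- int n - 1) (ann (dual b) (Suc n) (creation_word u)))
        + (if n = m then of_nat (Suc m) *v form (dual b) a *v A b (- int m - 1) (creation_word u) else 0))"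
      unfolding E_def
    proof (intro sum.cong refl)
      fix n b
      have "ann (dual b) (Suc n) (A a (- int m - 1) (creation_word u))
          = A a (- int m - 1) (ann (dual b) (Suc n) (creation_word u))
            + (if n = m then of_nat (Suc m) * form (dual b) a else 0) *v creation_word u"
        using ann_A[OF creation_word_W, of "dual b" "Suc n" a "- int m - 1" u] by simp
      moreover have "A b (- int n - 1) (A a (- int m - 1) (ann (dual b) (Suc n) (creation_word u)))
          = A a (- int m - 1) (A b (- int n - 1) (ann (dual b) (Suc n) (creation_word u)))"
        using A_commute[OF ann_W[OF creation_word_W], of b "- int n - 1" a "- int m - 1"] by simp
      ultimately show "A b (- int n - 1) (ann (dual b) (Suc n) (A a (- int m - 1) (creation_word u)))
          = A a (- int m - 1) (A b (- int n - 1) (ann (dual b) (Suc n) (creation_word u)))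
        + (if n = m then of_nat (Suc m) *v form (dual b) a *v A b (- int m - 1) (creation_word u) else 0)"
        by (simp add: A_add A_scale)
    qed
    also have "\<dots> = A a (- int m - 1) (E N (creation_word u))
        + of_nat (Suc m) *v (\<Sum>b\<in>B. form (dual b) a *v A b (- int m - 1) (creation_word u))"
      using m by (simp add: E_def sum.distrib A_sum sum.delta' V.scale_sum_right
          sum.swap[of _ B] cong: if_cong del: of_nat_Suc)
    also have "(\<Sum>b\<in>B. form (dual b) a *v A b (- int m - 1) (creation_word u))
        = A (\<Sum>b\<in>B. scale (form (dual b) a) b) (- int m - 1) (creation_word u)"
      by (simp add: A_sum_left A_scale_left)
    also have "\<dots> = A a (- int m - 1) (creation_word u)" using dual[of a] by simp
    finally show ?case using Cons
      by (simp add: p A_scale V.scale_left_distrib algebra_simps)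
  qed
  define Q where "Q N D v = fold (\<lambda>d v. E N v - of_nat (Suc d) *v v) [0..<D] v" for N D v
  have Q_Suc: "Q N (Suc D) v = E N (Q N D v) - of_nat (Suc D) *v Q N D v" for N D v
    by (simp add: Q_def)
  have Q_0: "Q N 0 v = v" for N v by (simp add: Q_def)
  have Q_lin: "Q N D (v + w) = Q N D v + Q N D w" "Q N D (c *v v) = c *v Q N D v" for N D c v w
    by (induction D) (simp_all add: Q_0 Q_Suc E_add E_scale algebra_simps del: of_nat_Suc)
  have Q_eigen: "Q N D v = (\<Prod>d<D. e - of_nat (Suc d)) *v v" if "E N v = e *v v" for N D v e
    by (induction D)
       (simp_all add: Q_0 Q_Suc E_scale that algebra_simps del: of_nat_Suc)
  have "\<exists>N0 D0. \<forall>N\<ge>N0. \<forall>D\<ge>D0. Q N D v \<in> V.span {vac}"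
  proof -
    have "v \<in> V.span (range creation_word)" using W_span_creation_words assms by blast
    then show ?thesis
    proof (induction rule: V.span_induct_alt)
      case base
      have "Q N D 0 = 0" for N D using Q_lin(2)[of N D 0 0] by simp
      then show ?case by (simp add: V.span_zero)
    next
      case (step c x y)
      obtain u where x: "x = creation_word u" using step by blast
      obtain N0 D0 where ND: "\<And>N D. N \<ge> N0 \<Longrightarrow> D \<ge> D0 \<Longrightarrow> Q N D y \<in> V.span {vac}"
        using step by blast
      define wt where "wt = (\<Sum>(a, n)\<leftarrow>u. Suc n)"
      define N1 where "N1 = Suc (Max (insert 0 (snd ` set u)))"
      have N1: "n < N" if "(a, n) \<in> set u" "N \<ge> N1" for a n N
      proof -
        have "n \<le> Max (insert 0 (snd ` set u))" using that by (intro Max_ge) force+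
        then show ?thesis using that unfolding N1_def by simp
      qed
      have "Q N D x \<in> V.span {vac}" if "N \<ge> N1" "D \<ge> wt" for N D
      proof (cases u)
        case Nil
        then show ?thesis
          using Q_eigen[OF E_creation_word[of u N]] by (simp add: x V.span_base V.span_scale)
      next
        case (Cons p u')
        then have "wt > 0" by (auto simp: wt_def split: prod.splits)
        then have "(\<Prod>d<D. of_nat wt - of_nat (Suc d) :: complex) = 0"
          using that by (intro prod_zero) (auto intro!: bexI[of _ "wt - 1"])
        then have "Q N D x = 0"
          using Q_eigen[OF E_creation_word[of u N], of D] N1 that unfolding x wt_def by force
        then show ?thesis by (simp add: V.span_zero)
      qed
      then have "\<forall>N\<ge>max N0 N1. \<forall>D\<ge>max D0 wt. Q N D (c *v x + y) \<in> V.span {vac}"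
        using ND by (simp add: Q_lin V.span_add V.span_scale)
      then show ?case by blast
    qed
  qed
  then obtain N D where "Q N D v \<in> V.span {vac}" by blast
  moreover have "Q N D v = (\<Prod>d<D. 0 - of_nat (Suc d)) *v v"
    by (rule Q_eigen) (simp add: E_def null)
  moreover have "(\<Prod>d<D. 0 - of_nat (Suc d) :: complex) \<noteq> 0"
    by (simp del: of_nat_Suc)
  ultimately obtain c where c: "c *v v \<in> V.span {vac}" "c \<noteq> 0" by metis
  have "inverse c *v (c *v v) \<in> V.span {vac}" by (rule V.span_scale) (rule c)
  then show ?thesis using c(2) by simp
qed

text \<open>
  A nonzero submodule contains a common null vector of all \<open>ann a n\<close>, which is a multiple of \<open>vac\<close>, and
  \<open>vac\<close> generates everything.
\<close>

theorem W_irreducible: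
  assumes "S \<subseteq> W" "V.subspace S" "\<And>a k v. v \<in> S \<Longrightarrow> A a k v \<in> S"
    and "v \<in> S" "v \<noteq> 0"
  shows "W \<subseteq> S"
proof -
  obtain u where u: "u \<in> S" "u \<noteq> 0" "\<And>a n. ann a n u = 0"
    using exists_common_null_vector[OF assms] by blast
  then have "u \<in> V.span {vac}" using joint_kernel_in_span_vac assms(1) by blast
  then obtain c where c: "u = c *v vac" by (auto simp: V.span_singleton)
  then have "vac = inverse c *v u" using u(2) by auto
  then have "vac \<in> S" using u(1) assms(2) by (simp add: V.subspace_scale)
  then show ?thesis using W_generated assms(2,3) by blast
qed

end

section \<open>Separating the terms of a mode by interpolation\<close>

text \<open>
  The coefficient of \<open>a(k)\<close> in the field \<open>(1/n!) \<partial>\<^sup>n a(z)\<close>. As functions of \<open>k\<close>, these binomial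
  coefficients span the polynomials, which separate the points of any finite set of integers.
\<close>

definition mode_coeff :: "nat \<Rightarrow> int \<Rightarrow> complex" where
  "mode_coeff n k = of_int (- k - 1) gchoose n"

inductive_set mode_coeff_span :: "(int \<Rightarrow> complex) set" where
  coeff: "mode_coeff n \<in> mode_coeff_span"
| add: "f \<in> mode_coeff_span \<Longrightarrow> g \<in> mode_coeff_span \<Longrightarrow> (\<lambda>k. f k + g k) \<in> mode_coeff_span"
| scale: "f \<in> mode_coeff_span \<Longrightarrow> (\<lambda>k. c * f k) \<in> mode_coeff_span"

text \<open>
  With \<open>x = -k - 1\<close>, this is the identity \<open>x (x choose n) = n (x choose n) + (n + 1) (x choose n + 1)\<close>.
\<close>

lemma mode_coeff_span_times:
  assumes "f \<in> mode_coeff_span"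
  shows "(\<lambda>k. of_int k * f k) \<in> mode_coeff_span"
  using assms
proof induction
  case (coeff n)
  have "of_int k * mode_coeff n k
      = (- of_nat (Suc n)) * mode_coeff n k + (- of_nat (Suc n)) * mode_coeff (Suc n) k" for k
  proof -
    define x :: complex where "x = of_int (- k - 1)"
    have "of_int k * (x gchoose n) = - (x gchoose n) - x * (x gchoose n)"
      by (simp add: x_def algebra_simps)
    also have "x * (x gchoose n) = of_nat n * (x gchoose n) + of_nat (Suc n) * (x gchoose Suc n)"
      by (rule gbinomial_mult_1)
    finally show ?thesis unfolding mode_coeff_def x_def[symmetric] by (simp add: algebra_simps)
  qed
  then show ?case
    by (simp only:) (intro mode_coeff_span.intros)
next
  case (add f g)
  then show ?case using mode_coeff_span.add by (simp add: distrib_left)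
next
  case (scale f c)
  then show ?case using mode_coeff_span.scale[of "\<lambda>k. of_int k * f k" c]
    by (simp add: mult.left_commute)
qed

text \<open>
  Lagrange interpolation: multiply by \<open>(j - i) / (k - i)\<close> for each \<open>i \<noteq> k\<close> in the given set.
\<close>

lemma mode_coeff_span_delta:
  assumes "finite J"
  shows "\<exists>f\<in>mode_coeff_span. f k = 1 \<and> (\<forall>j\<in>J - {k}. f j = 0)"
  using assms
proof induction
  case empty
  show ?case by (intro bexI[of _ "mode_coeff 0"]) (auto simp: mode_coeff_def intro: coeff)
next
  case (insert i J)
  then obtain f where f: "f \<in> mode_coeff_span" "f k = 1" "\<forall>j\<in>J - {k}. f j = 0" by blast
  show ?case
  proof (cases "i = k")
    case True
    then show ?thesis using f by blast
  next
    case False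
    define c :: complex where "c = inverse (of_int k - of_int i)"
    have c: "c * (of_int k - of_int i) = 1" using False by (simp add: c_def)
    define g where "g j = c * (of_int j * f j + (- of_int i) * f j)" for j
    have "g \<in> mode_coeff_span"
      unfolding g_def using f by (intro mode_coeff_span.intros mode_coeff_span_times)
    moreover have g: "g j = c * (of_int j - of_int i) * f j" for j
      by (simp add: g_def algebra_simps)
    ultimately show ?thesis using f c by (intro bexI[of _ g]) auto
  qed
qed

abbreviation prod_apply :: "(int \<Rightarrow> complex) list \<Rightarrow> int list \<Rightarrow> complex" where
  "prod_apply fs ks \<equiv> prod_list (map2 (\<lambda>f k. f k) fs ks)"

lemma prod_apply_split:
  "length fs < length ks \<Longrightarrow> prod_apply (fs @ f # gs) ks =
     prod_apply fs ks * f (ks ! length fs) * prod_apply gs (drop (Suc (length fs)) ks)"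
proof (induction fs arbitrary: ks)
  case Nil
  then show ?case by (cases ks) auto
next
  case (Cons h fs)
  then show ?case by (cases ks) (auto simp: mult.assoc)
qed

lemma prod_apply_delta:
  assumes "length ks = length js"
    and "\<And>i j. i \<in> set js \<Longrightarrow> j \<in> set ks \<Longrightarrow> d i j = (if j = i then 1 else 0)"
  shows "prod_apply (map d js) ks = (if ks = js then 1 else 0)"
  using assms by (induction ks js rule: list_induct2) auto

text \<open>
  The sums are multilinear in the coefficient functions, so they stay in \<open>S\<close> when each binomial
  coefficient is replaced, one position after another, by a combination of them. With delta
  functions in all positions only the term at \<open>js\<close> survives.
\<close>

lemma interpolation:
  fixes sv :: "complex \<Rightarrow> 'v::ab_group_add \<Rightarrow> 'v" and T :: "int list \<Rightarrow> 'v"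
  assumes "vector_space sv" and S: "module.subspace sv S"
    and K: "finite K" "\<And>ks. ks \<in> K \<Longrightarrow> length ks = r"
    and modes: "\<And>ns. length ns = r \<Longrightarrow>
      (\<Sum>ks\<in>K. sv (prod_apply (map mode_coeff ns) ks) (T ks)) \<in> S"
    and js: "js \<in> K"
  shows "T js \<in> S"
proof -
  interpret V: vector_space sv by fact
  define Q where "Q fs = (\<Sum>ks\<in>K. sv (prod_apply fs ks) (T ks))" for fs
  have Q_add: "Q (fs @ (\<lambda>k. f k + g k) # gs) = Q (fs @ f # gs) + Q (fs @ g # gs)"
    and Q_scale: "Q (fs @ (\<lambda>k. c * f k) # gs) = sv c (Q (fs @ f # gs))"
    if "length fs < r" for fs gs f g c
    using K(2) that unfolding Q_def
    by (auto simp: prod_apply_split distrib_left distrib_right V.scale_left_distrib sum.distrib[symmetric]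
        V.scale_sum_right mult_ac intro!: sum.cong)
  have "Q (fs @ map mode_coeff ns) \<in> S"
    if "set fs \<subseteq> mode_coeff_span" "length fs + length ns = r" for fs ns
    using that
  proof (induction fs arbitrary: ns rule: rev_induct)
    case Nil
    then show ?case using modes[of ns] by (simp add: Q_def)
  next
    case (snoc f fs)
    have len: "length fs < r" using snoc.prems by simp
    have "f \<in> mode_coeff_span" using snoc.prems by simp
    then have "Q (fs @ f # map mode_coeff ns) \<in> S"
    proof induction
      case (coeff n)
      show ?case using snoc.IH[of "n # ns"] snoc.prems by simp
    qed (use len S in \<open>auto simp: Q_add Q_scale V.subspace_add V.subspace_scale\<close>)
    then show ?case by simp
  qed
  note Q_span = this[of _ "[]", simplified]
  define J where "J = \<Union> (set ` K)"
  have "\<exists>d\<in>mode_coeff_span. d i = 1 \<and> (\<forall>j\<in>J - {i}. d j = 0)" for i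
    by (rule mode_coeff_span_delta) (simp add: J_def K)
  then obtain d where d: "\<And>i. d i \<in> mode_coeff_span" "\<And>i. d i i = 1"
      "\<And>i j. j \<in> J \<Longrightarrow> j \<noteq> i \<Longrightarrow> d i j = 0"
    by (metis Diff_iff singletonD)
  have "Q (map d js) \<in> S" using d K(2) js by (intro Q_span) auto
  also have "Q (map d js) = (\<Sum>ks\<in>K. if ks = js then T js else 0)"
    unfolding Q_def
  proof (intro sum.cong refl)
    fix ks assume ks: "ks \<in> K"
    have "prod_apply (map d js) ks = (if ks = js then 1 else 0)"
    proof (rule prod_apply_delta)
      show "length ks = length js" using K(2) js ks by simp
      fix i j assume "j \<in> set ks"
      then have "j \<in> J" using ks by (auto simp: J_def)
      then show "d i j = (if j = i then 1 else 0)" using d(2,3) by simp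
    qed
    then show "sv (prod_apply (map d js) ks) (T ks) = (if ks = js then T js else 0)" by simp
  qed
  also have "\<dots> = T js" using K js by simp
  finally show ?thesis .
qed

section \<open>Normally ordered words and their twists\<close>

context whittaker_operators
begin

text \<open>
  Normal ordering: creation operators are applied last. Among the others the first letter acts first,
  following the recursion \<open>:A(z) B(z): = A\<^sub>-(z) B(z) + B(z) A\<^sub>+(z)\<close>.
\<close>

primrec nord :: "('h \<times> int) list \<Rightarrow> 'v \<Rightarrow> 'v" where
  "nord [] v = v"
| "nord (x # u) v =
    (if snd x < 0 then A (fst x) (snd x) (nord u v) else nord u (A (fst x) (snd x) v))"

lemma nord_add: "nord u (v + w) = nord u v + nord u w"
  by (induction u arbitrary: v w) (simp_all add: A_add)

lemma nord_scale: "nord u (c *v v) = c *v nord u v"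
  by (induction u arbitrary: v) (simp_all add: A_scale)

lemma nord_zero [simp]: "nord u 0 = 0"
  by (induction u) simp_all

lemma nord_W: "v \<in> W \<Longrightarrow> nord u v \<in> W"
  by (induction u arbitrary: v) (simp_all add: A_W)

lemma A_bounded_step:
  assumes "v \<in> W" "\<forall>a. \<forall>k\<ge>int N. A a k v = 0" "1 \<le> N" "0 \<le> l"
  shows "\<forall>a. \<forall>k\<ge>int N. A a k (A b l v) = 0"
  using assms A_commute[OF assms(1), of _ _ b l] by auto

lemma nord_eq_0:
  assumes "v \<in> W" "\<forall>a. \<forall>k\<ge>int N. A a k v = 0" "1 \<le> N" "x \<in> set u" "int N \<le> snd x"
  shows "nord u v = 0"
  using assms
proof (induction u arbitrary: v)
  case (Cons y u)
  show ?case
  proof (cases "x \<in> set u \<and> y \<noteq> x")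
    case True
    then show ?thesis using Cons A_bounded_step[OF Cons.prems(1,2,3), of "snd y" "fst y"]
      by (simp add: A_W)
  next
    case False
    then show ?thesis using Cons.prems by auto
  qed
qed simp

subsection \<open>Simultaneous action of words and their twists\<close>

text \<open>
  Replacing \<open>a\<close> by \<open>g a\<close> in all letters turns the action on \<open>M(1, lam)\<close> into that on a twisted module.
  The families \<open>g \<mapsto> t g\<close> below are vectors of the direct sum of the twists by \<open>g \<in> G\<close>, and
  \<open>twist_family G X\<close> is the span of the images of such a vector \<open>X\<close> under normally ordered words.
  Values outside \<open>G\<close> carry no information, so membership depends only on the values on \<open>G\<close>.
\<close>

inductive_set twist_family :: "('h \<Rightarrow> 'h) set \<Rightarrow> (('h \<Rightarrow> 'h) \<Rightarrow> 'v) \<Rightarrow> (('h \<Rightarrow> 'h) \<Rightarrow> 'v) set"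
  for G X where
  word: "(\<And>g. g \<in> G \<Longrightarrow> t g = nord (map (map_prod g id) u) (X g)) \<Longrightarrow> t \<in> twist_family G X"
| add: "s \<in> twist_family G X \<Longrightarrow> r \<in> twist_family G X \<Longrightarrow> (\<And>g. g \<in> G \<Longrightarrow> t g = s g + r g)
    \<Longrightarrow> t \<in> twist_family G X"
| scale: "s \<in> twist_family G X \<Longrightarrow> (\<And>g. g \<in> G \<Longrightarrow> t g = c *v s g) \<Longrightarrow> t \<in> twist_family G X"

lemma twist_family_cong: "s \<in> twist_family G X \<Longrightarrow> (\<And>g. g \<in> G \<Longrightarrow> t g = s g) \<Longrightarrow> t \<in> twist_family G X"
  by (rule twist_family.scale[of s _ _ _ 1]) auto

lemma twist_family_W: "t \<in> twist_family G X \<Longrightarrow> (\<And>g. g \<in> G \<Longrightarrow> X g \<in> W) \<Longrightarrow> g \<in> G \<Longrightarrow> t g \<in> W"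
  by (induction rule: twist_family.induct)
     (auto simp: nord_W W_subspace V.subspace_add V.subspace_scale)

lemma twist_family_creation:
  assumes "t \<in> twist_family G X" "k < 0"
  shows "(\<lambda>g. A (g a) k (t g)) \<in> twist_family G X"
  using assms(1)
proof induction
  case (word t u)
  then show ?case by (intro twist_family.word[of _ _ "(a, k) # u"]) (simp add: assms(2))
next
  case (add s r t)
  show ?case by (rule twist_family.add[OF add(4,5)]) (simp add: add A_add)
next
  case (scale s t c)
  show ?case by (rule twist_family.scale[OF scale(3), of _ c]) (simp add: scale A_scale)
qed

lemma twist_family_shift:
  assumes "t \<in> twist_family G (\<lambda>g. A (g b) l (X g))" "0 \<le> l"
  shows "t \<in> twist_family G X"
  using assms(1)
proof induction
  case (word t u)
  then show ?case by (intro twist_family.word[of _ _ "(b, l) # u"]) (use assms(2) in simp)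
qed (auto intro: twist_family.add twist_family.scale)

text \<open>
  Moving \<open>(g a)(k)\<close> to the right past the creation operators produces scalars \<open>k (g a, g b) = k (a, b)\<close>.
  They are the same for all \<open>g\<close>, so the same combination of words works for every twist at once. The
  letters \<open>b(l)\<close> with \<open>l \<ge> 0\<close> are absorbed into the starting vector, which is why \<open>X\<close> is a family.
\<close>

lemma twist_family_annihilation:
  assumes "\<And>g a b. g \<in> G \<Longrightarrow> form (g a) (g b) = form a b"
    and "\<And>g. g \<in> G \<Longrightarrow> X g \<in> W" and "0 \<le> k"
  shows "(\<lambda>g. A (g a) k (nord (map (map_prod g id) u) (X g))) \<in> twist_family G X"
  using assms(2)
proof (induction u arbitrary: X)
  case Nil
  show ?case by (intro twist_family.word[of _ _ "[(a, k)]"]) (use assms(3) in simp)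
next
  case (Cons x u)
  obtain b l where x: "x = (b, l)" by force
  show ?case
  proof (cases "l < 0")
    case True
    let ?n = "\<lambda>g. nord (map (map_prod g id) u) (X g)"
    have 1: "(\<lambda>g. A (g b) l (A (g a) k (?n g))) \<in> twist_family G X"
      by (rule twist_family_creation[OF Cons.IH True]) (rule Cons.prems)
    have 2: "(\<lambda>g. (if k + l = 0 then of_int k * form a b else 0) *v ?n g) \<in> twist_family G X"
      by (rule twist_family.scale[OF twist_family.word[of _ ?n u]]) (rule refl)+
    show ?thesis
    proof (rule twist_family.add[OF 1 2])
      fix g assume g: "g \<in> G"
      then have "?n g \<in> W" by (simp add: nord_W Cons.prems)
      from A_commute[OF this, of "g a" k "g b" l]
      show "A (g a) k (nord (map (map_prod g id) (x # u)) (X g))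
        = A (g b) l (A (g a) k (?n g)) + (if k + l = 0 then of_int k * form a b else 0) *v ?n g"
        using True by (simp add: x assms(1)[OF g])
    qed
  next
    case False
    have "(\<lambda>g. A (g a) k (nord (map (map_prod g id) u) (A (g b) l (X g))))
      \<in> twist_family G (\<lambda>g. A (g b) l (X g))"
      by (rule Cons.IH) (simp add: A_W Cons.prems)
    then have "(\<lambda>g. A (g a) k (nord (map (map_prod g id) u) (A (g b) l (X g)))) \<in> twist_family G X"
      by (rule twist_family_shift) (use False in simp)
    then show ?thesis using False by (simp add: x id_def)
  qed
qed

lemma twist_family_act:
  assumes "\<And>g a b. g \<in> G \<Longrightarrow> form (g a) (g b) = form a b"
    and "\<And>g. g \<in> G \<Longrightarrow> X g \<in> W" and "t \<in> twist_family G X"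
  shows "(\<lambda>g. A (g a) k (t g)) \<in> twist_family G X"
proof (cases "k < 0")
  case True
  then show ?thesis using twist_family_creation assms(3) by blast
next
  case False
  show ?thesis using assms(3)
  proof induction
    case (word t u)
    show ?case
      by (rule twist_family_cong[OF twist_family_annihilation[OF assms(1,2), where k = k and a = a and u = u]])
         (use False word in auto)
  next
    case (add s r t)
    show ?case by (rule twist_family.add[OF add(4,5)]) (simp add: add A_add)
  next
    case (scale s t c)
    show ?case by (rule twist_family.scale[OF scale(3), of _ c]) (simp add: scale A_scale)
  qed
qed

text \<open>
  In the direct sum of the twists, consider the submodule generated by the diagonal vector \<open>v\<close>. On the
  component \<open>g\<close> the commuting operators \<open>a(n)\<close>, \<open>n \<ge> 0\<close>, have the single generalised eigenvalue
  \<open>mu (g a) n\<close>. For \<open>h \<noteq> id\<close> choose \<open>a(n)\<close> with \<open>mu (h a) n \<noteq> mu a n\<close>: a high power of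
  \<open>a(n) - mu (h a) n\<close> kills the component \<open>h\<close> and is injective on the component \<open>id\<close>. Treating all
  \<open>h\<close> in this way leaves a nonzero vector supported on \<open>id\<close>, and by irreducibility every such vector
  lies in the submodule. For a family supported on \<open>id\<close> the sum over \<open>G\<close> is its value at \<open>id\<close>.
\<close>

theorem twisted_sums_generate:
  assumes G: "finite G" "id \<in> G"
    and form: "\<And>g a b. g \<in> G \<Longrightarrow> form (g a) (g b) = form a b"
    and separated: "\<And>g. g \<in> G \<Longrightarrow> g \<noteq> id \<Longrightarrow> \<exists>a n. mu (g a) n \<noteq> mu a n"
    and v: "v \<in> W" "v \<noteq> 0"
    and S: "V.subspace S" "\<And>u. (\<Sum>g\<in>G. nord (map (map_prod g id) u) v) \<in> S"
  shows "W \<subseteq> S"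
proof -
  define F where "F = twist_family G (\<lambda>_. v)"
  have F_W: "t g \<in> W" if "t \<in> F" "g \<in> G" for t g
    using twist_family_W that v(1) unfolding F_def by blast
  have F_act: "(\<lambda>g. A (g a) k (t g)) \<in> F" if "t \<in> F" for a k t
    unfolding F_def by (rule twist_family_act[OF form v(1) that[unfolded F_def]])
  have F_sum: "(\<Sum>g\<in>G. t g) \<in> S" if "t \<in> F" for t
    using that unfolding F_def
  proof induction
    case (word t u)
    then show ?case using S(2)[of u] by simp
  qed (use S(1) in \<open>simp_all add: sum.distrib V.subspace_add V.subspace_scale
        flip: V.scale_sum_right\<close>)
  have separate: "\<exists>t\<in>F. t id \<noteq> 0 \<and> (\<forall>g\<in>H. t g = 0)" if "finite H" "H \<subseteq> G - {id}" for H
    using that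
  proof induction
    case empty
    have "(\<lambda>_. v) \<in> F" unfolding F_def by (rule twist_family.word[of _ _ "[]"]) simp
    then show ?case using v by auto
  next
    case (insert h H)
    then obtain t where t: "t \<in> F" "t id \<noteq> 0" "\<forall>g\<in>H. t g = 0" by blast
    obtain a n where an: "mu (h a) n \<noteq> mu a n" using separated insert.prems by blast
    define d where "d g w = A (g a) (int n) w - mu (h a) n *v w" for g w
    have d_W: "d g w \<in> W" if "w \<in> W" for g w
      using that by (simp add: d_def A_W W_subspace V.subspace_diff V.subspace_scale)
    have pow_W: "(d g ^^ j) w \<in> W" if "w \<in> W" for g w j
      using that by (induction j) (simp_all add: d_W)
    have pow_0: "(d g ^^ j) 0 = 0" for g j
      by (induction j) (simp_all add: d_def)
    have pow_F: "(\<lambda>g. (d g ^^ j) (t g)) \<in> F" for j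
    proof (induction j)
      case (Suc j)
      show ?case unfolding F_def
        by (rule twist_family.add[OF F_act[OF Suc, unfolded F_def, of a "int n"]
              twist_family.scale[OF Suc[unfolded F_def], of _ "- mu (h a) n"]])
           (auto simp: d_def)
    qed (simp add: t)
    have d_inj: "w = 0" if "w \<in> W" "d id w = 0" for w
    proof -
      have ann: "ann a n w = (mu (h a) n - mu a n) *v w"
        using that(2) by (simp add: ann_def d_def algebra_simps)
      have "(ann a n ^^ j) w = (mu (h a) n - mu a n) ^ j *v w" for j
        by (induction j) (simp_all add: ann_scale ann mult.commute)
      then show "w = 0" using ann_locally_nilpotent[OF that(1), of a n] an by auto
    qed
    have pow_inj: "(d id ^^ j) (t id) \<noteq> 0" for j
    proof (induction j)
      case (Suc j)
      have "(d id ^^ j) (t id) \<in> W" by (rule pow_W[OF F_W[OF t(1) G(2)]])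
      then have "d id ((d id ^^ j) (t id)) \<noteq> 0" using d_inj Suc by blast
      then show ?case by (simp only: funpow.simps o_apply not_False_eq_True)
    qed (use t(2) in \<open>simp add: id_def\<close>)
    have "d h = ann (h a) n" by (auto simp: d_def ann_def)
    then obtain j where "(d h ^^ j) (t h) = 0"
      using ann_locally_nilpotent[OF F_W[OF t(1), of h], of "h a" n] insert.prems by auto
    then have "\<forall>g\<in>insert h H. (d g ^^ j) (t g) = 0" using t(3) pow_0 by simp
    then show ?case
      by (intro bexI[of _ "\<lambda>g. (d g ^^ j) (t g)"] conjI pow_F[of j] pow_inj[of j])
  qed
  obtain t where t: "t \<in> F" "t id \<noteq> 0" "\<forall>g\<in>G - {id}. t g = 0"
    using separate[of "G - {id}"] G by auto
  define F0 where "F0 = {t \<in> F. \<forall>g\<in>G - {id}. t g = 0}"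
  define S0 where "S0 = (\<lambda>t. t id) ` F0"
  have "W \<subseteq> S0"
  proof (rule W_irreducible)
    show "S0 \<subseteq> W" using F_W G(2) by (auto simp: S0_def F0_def)
    show "V.subspace S0"
    proof (rule V.subspaceI)
      have "(\<lambda>_. 0) \<in> F" unfolding F_def
        by (rule twist_family.scale[OF t(1)[unfolded F_def], of _ 0]) simp
      then have "(\<lambda>_. 0) \<in> F0" by (simp add: F0_def)
      then show "0 \<in> S0" unfolding S0_def by (rule rev_image_eqI) simp
    next
      fix x y assume "x \<in> S0" "y \<in> S0"
      then obtain s r where s: "s \<in> F0" "x = s id" and r: "r \<in> F0" "y = r id"
        by (auto simp: S0_def)
      have "(\<lambda>g. s g + r g) \<in> F" unfolding F_def
        by (rule twist_family.add[where s = s and r = r]) (use s r in \<open>simp_all add: F0_def F_def\<close>)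
      then have "(\<lambda>g. s g + r g) \<in> F0" using s r by (simp add: F0_def)
      then show "x + y \<in> S0" unfolding S0_def by (rule rev_image_eqI) (simp add: s r)
    next
      fix c x assume "x \<in> S0"
      then obtain s where s: "s \<in> F0" "x = s id" by (auto simp: S0_def)
      have "(\<lambda>g. c *v s g) \<in> F" unfolding F_def
        by (rule twist_family.scale[where s = s and c = c]) (use s in \<open>simp_all add: F0_def F_def\<close>)
      then have "(\<lambda>g. c *v s g) \<in> F0" using s by (simp add: F0_def)
      then show "c *v x \<in> S0" unfolding S0_def by (rule rev_image_eqI) (simp add: s)
    qed
    show "A a k x \<in> S0" if "x \<in> S0" for a k x
    proof -
      obtain s where s: "s \<in> F0" "x = s id" using \<open>x \<in> S0\<close> by (auto simp: S0_def)
      then have "(\<lambda>g. A (g a) k (s g)) \<in> F0"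
        using F_act[of s a k] by (simp add: F0_def)
      then show ?thesis unfolding S0_def by (rule rev_image_eqI) (simp add: s)
    qed
    show "t id \<in> S0" using t(1,3) unfolding S0_def by (intro imageI) (simp add: F0_def)
    show "t id \<noteq> 0" by (fact t)
  qed
  moreover have "S0 \<subseteq> S"
  proof
    fix x assume "x \<in> S0"
    then obtain s where s: "x = s id" "s \<in> F" "\<forall>g\<in>G - {id}. s g = 0"
      by (auto simp: S0_def F0_def)
    have "(\<Sum>g\<in>G. s g) = s id"
      using s(3) G by (simp add: sum.remove[of G id])
    then show "x \<in> S" using F_sum[OF s(2)] s(1) by simp
  qed
  ultimately show ?thesis by blast
qed

subsection \<open>Modes of normally ordered products\<close>

text \<open>
  If \<open>a(k)\<close> kills \<open>v\<close> for all \<open>k \<ge> N\<close>, only tuples below \<open>N\<close> contribute to a mode applied to \<open>v\<close>. The sum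
  of the entries is fixed by the mode, so there are finitely many of them.
\<close>

definition bounded_tuples :: "nat \<Rightarrow> nat \<Rightarrow> int \<Rightarrow> int list set" where
  "bounded_tuples N r s = {ks. length ks = r \<and> sum_list ks = s \<and> (\<forall>k\<in>set ks. k < int N)}"

definition mode :: "nat \<Rightarrow> ('h \<times> nat) list \<Rightarrow> int \<Rightarrow> 'v \<Rightarrow> 'v" where
  "mode N w m v =
    (\<Sum>ks\<in>bounded_tuples N (length w) (m + 1 - (\<Sum>(a, n)\<leftarrow>w. int n + 1)).
      prod_apply (map (mode_coeff \<circ> snd) w) ks *v nord (zip (map fst w) ks) v)"

lemma sum_list_bounded:
  assumes "\<forall>k\<in>set ks. k < int N"
  shows "sum_list ks \<le> int (length ks * N)"
  using assms by (induction ks) auto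

lemma bounded_tuples_lower:
  assumes "ks \<in> bounded_tuples N r s" "k \<in> set ks"
  shows "s - int (r * N) \<le> k"
proof -
  obtain xs ys where ks: "ks = xs @ k # ys" using assms(2) by (meson split_list)
  have "sum_list (xs @ ys) \<le> int (length (xs @ ys) * N)"
    using assms(1) by (intro sum_list_bounded) (auto simp: bounded_tuples_def ks)
  also have "length (xs @ ys) * N \<le> r * N"
    using assms(1) by (intro mult_right_mono) (auto simp: bounded_tuples_def ks)
  finally show ?thesis using assms(1) by (auto simp: bounded_tuples_def ks)
qed

lemma finite_bounded_tuples: "finite (bounded_tuples N r s)"
proof (rule finite_subset)
  show "bounded_tuples N r s \<subseteq> {ks. set ks \<subseteq> {s - int (r * N)..<int N} \<and> length ks = r}"
    using bounded_tuples_lower by (auto simp: bounded_tuples_def)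
  show "finite {ks. set ks \<subseteq> {s - int (r * N)..<int N} \<and> length ks = r}"
    by (rule finite_lists_length_eq) simp
qed

lemma mode_Nil: "mode N [] m v = (if m = - 1 then v else 0)"
proof -
  have "bounded_tuples N 0 (m + 1) = (if m = - 1 then {[]} else {})"
    by (auto simp: bounded_tuples_def)
  then show ?thesis by (simp add: mode_def)
qed

lemma mode_zero [simp]: "mode N w m 0 = 0"
  by (simp add: mode_def)

text \<open>
  The summands of the recursion that defines \<open>normal_mode\<close>. They serve to compare that recursion,
  which sums over all integers, with the closed formula \<open>mode\<close>.
\<close>

definition mode_term :: "nat \<Rightarrow> 'h \<Rightarrow> nat \<Rightarrow> ('h \<times> nat) list \<Rightarrow> int \<Rightarrow> 'v \<Rightarrow> int \<Rightarrow> 'v" where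
  "mode_term N a n w m v k = mode_coeff n k *v
     (if k < 0 then A a k (mode N w (m - k - int n - 1) v)
      else mode N w (m - k - int n - 1) (A a k v))"

lemma mode_Cons:
  assumes bound: "\<forall>a. \<forall>k\<ge>int N. A a k v = 0"
  obtains I where "finite I" "{k. mode_term N a n w m v k \<noteq> 0} \<subseteq> I"
    "mode N ((a, n) # w) m v = (\<Sum>k\<in>I. mode_term N a n w m v k)"
proof
  define r where "r = length w"
  define s where "s = m + 1 - (\<Sum>(a, n)\<leftarrow>(a, n) # w. int n + 1)"
  define I where "I = {s - int (r * N)..<int N}"
  have s_tail: "m - k - int n - 1 + 1 - (\<Sum>(a, n)\<leftarrow>w. int n + 1) = s - k" for k
    by (simp add: s_def)
  have mode_tail: "mode N w (m - k - int n - 1) x = (\<Sum>ks\<in>bounded_tuples N r (s - k).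
      prod_apply (map (mode_coeff \<circ> snd) w) ks *v nord (zip (map fst w) ks) x)" for k x
    unfolding mode_def r_def s_tail ..
  show "finite I" by (simp add: I_def)
  show "{k. mode_term N a n w m v k \<noteq> 0} \<subseteq> I"
  proof safe
    fix k assume nz: "mode_term N a n w m v k \<noteq> 0"
    have "k < int N"
    proof (rule ccontr)
      assume "\<not> k < int N"
      then have "A a k v = 0" "\<not> k < 0" using bound by auto
      then show False using nz by (simp add: mode_term_def)
    qed
    moreover have "bounded_tuples N r (s - k) \<noteq> {}"
      using nz by (auto simp: mode_term_def mode_tail split: if_splits)
    then obtain ks where "ks \<in> bounded_tuples N r (s - k)" by blast
    then have "s - k \<le> int (r * N)"
      using sum_list_bounded[of ks N] by (auto simp: bounded_tuples_def)
    ultimately show "k \<in> I" by (simp add: I_def)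
  qed
  let ?f = "\<lambda>ks. prod_apply (map (mode_coeff \<circ> snd) ((a, n) # w)) ks
    *v nord (zip (map fst ((a, n) # w)) ks) v"
  have "mode N ((a, n) # w) m v = (\<Sum>ks\<in>bounded_tuples N (Suc r) s. ?f ks)"
    by (simp add: mode_def r_def s_def)
  also have "\<dots> = (\<Sum>(k, ks)\<in>Sigma I (\<lambda>k. bounded_tuples N r (s - k)). ?f (k # ks))"
  proof (rule sum.reindex_bij_witness[of _ "\<lambda>(k, ks). k # ks" "\<lambda>ks. (hd ks, tl ks)"])
    fix ks assume ks: "ks \<in> bounded_tuples N (Suc r) s"
    then obtain k ks' where c: "ks = k # ks'" by (cases ks) (auto simp: bounded_tuples_def)
    have "ks' \<in> bounded_tuples N r (s - k)" using ks by (auto simp: bounded_tuples_def c)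
    moreover from this have "s - k \<le> int (r * N)"
      using sum_list_bounded[of ks' N] by (auto simp: bounded_tuples_def)
    ultimately show "(hd ks, tl ks) \<in> Sigma I (\<lambda>k. bounded_tuples N r (s - k))"
      using ks by (auto simp: I_def c bounded_tuples_def)
    show "(case (hd ks, tl ks) of (k, ks) \<Rightarrow> k # ks) = ks" by (simp add: c)
    show "(case (hd ks, tl ks) of (k, ks) \<Rightarrow> ?f (k # ks)) = ?f ks" by (simp add: c)
  qed (auto simp: bounded_tuples_def I_def)
  also have "\<dots> = (\<Sum>k\<in>I. \<Sum>ks\<in>bounded_tuples N r (s - k). ?f (k # ks))"
    by (rule sum.Sigma[symmetric]) (auto simp: I_def finite_bounded_tuples)
  also have "\<dots> = (\<Sum>k\<in>I. mode_term N a n w m v k)"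
    by (intro sum.cong refl)
       (auto simp: mode_term_def mode_tail A_sum A_scale V.scale_sum_right intro!: sum.cong)
  finally show "mode N ((a, n) # w) m v = (\<Sum>k\<in>I. mode_term N a n w m v k)" .
qed

text \<open>
  For fixed letters and a fixed sum of the indices, the averaged modes with varying derivatives are
  combinations of the same finitely many averaged normally ordered words, and interpolation recovers
  each word from them.
\<close>

theorem twisted_modes_generate:
  assumes G: "finite G" "id \<in> G"
    and form: "\<And>g a b. g \<in> G \<Longrightarrow> form (g a) (g b) = form a b"
    and separated: "\<And>g. g \<in> G \<Longrightarrow> g \<noteq> id \<Longrightarrow> \<exists>a n. mu (g a) n \<noteq> mu a n"
    and v: "v \<in> W" "v \<noteq> 0" and N: "1 \<le> N" "\<forall>a. \<forall>k\<ge>int N. A a k v = 0"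
    and S: "V.subspace S" "\<And>w m. (\<Sum>g\<in>G. mode N (map (map_prod g id) w) m v) \<in> S"
  shows "W \<subseteq> S"
proof (rule twisted_sums_generate[OF G form separated v S(1)])
  fix u :: "('h \<times> int) list"
  show "(\<Sum>g\<in>G. nord (map (map_prod g id) u) v) \<in> S"
  proof (cases "\<exists>x\<in>set u. int N \<le> snd x")
    case True
    have "nord (map (map_prod g id) u) v = 0" for g
      using True v(1) N by (force intro: nord_eq_0)
    then show ?thesis using S(1) by (simp add: V.subspace_0)
  next
    case False
    define as where "as = map fst u"
    define T where "T ks = (\<Sum>g\<in>G. nord (zip (map g as) ks) v)" for ks
    have "T (map snd u) \<in> S"
    proof (rule interpolation[where T = T])
      show "vector_space sv" by (rule V.vector_space_axioms)
      show "map snd u \<in> bounded_tuples N (length u) (sum_list (map snd u))"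
        using False by (auto simp: bounded_tuples_def)
      show "finite (bounded_tuples N (length u) (sum_list (map snd u)))"
        by (rule finite_bounded_tuples)
      show "length ks = length u"
        if "ks \<in> bounded_tuples N (length u) (sum_list (map snd u))" for ks
        using that by (simp add: bounded_tuples_def)
      fix ns :: "nat list" assume ns: "length ns = length u"
      define m where "m = sum_list (map snd u) - 1 + (\<Sum>n\<leftarrow>ns. int n + 1)"
      define w where "w = zip as ns"
      have w: "length w = length u" "map fst w = as" "map snd w = ns"
        by (simp_all add: w_def as_def ns)
      have "mode N (map (map_prod g id) w) m v
          = (\<Sum>ks\<in>bounded_tuples N (length u) (sum_list (map snd u)).
              prod_apply (map mode_coeff ns) ks *v nord (zip (map g as) ks) v)" for g
      proof -
        have "(\<Sum>(a, n)\<leftarrow>map (map_prod g id) w. int n + 1) = (\<Sum>n\<leftarrow>map snd w. int n + 1)"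
          by (simp add: case_prod_beta o_def)
        then have deg: "m + 1 - (\<Sum>(a, n)\<leftarrow>map (map_prod g id) w. int n + 1) = sum_list (map snd u)"
          unfolding w by (simp add: m_def)
        have maps: "map (mode_coeff \<circ> snd) (map (map_prod g id) w) = map mode_coeff ns"
          "map fst (map (map_prod g id) w) = map g as"
          unfolding w(2,3)[symmetric] by (simp_all add: o_def)
        show ?thesis unfolding mode_def deg maps by (simp add: w(1))
      qed
      then have "(\<Sum>g\<in>G. mode N (map (map_prod g id) w) m v)
          = (\<Sum>ks\<in>bounded_tuples N (length u) (sum_list (map snd u)).
              prod_apply (map mode_coeff ns) ks *v T ks)"
        by (simp add: T_def V.scale_sum_right sum.swap[of _ G])
      then show "(\<Sum>ks\<in>bounded_tuples N (length u) (sum_list (map snd u)).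
          prod_apply (map mode_coeff ns) ks *v T ks) \<in> S"
        using S(2)[of w m] by simp
    qed (rule S(1))
    moreover have "zip (map g as) (map snd u) = map (map_prod g id) u" for g :: "'h \<Rightarrow> 'h"
      unfolding as_def by (induction u) auto
    ultimately show ?thesis by (simp only: T_def)
  qed
qed

text \<open>
  The modes are symmetric and multilinear in the factors. This makes the mode of an element of
  \<open>M(1)\<close> independent of the way in which the element is written in monomials.
\<close>

lemma nord_swap:
  assumes "v \<in> W"
  shows "nord (x # y # u) v = nord (y # x # u) v"
proof (cases "snd x < 0 \<or> snd y < 0")
  case True
  then show ?thesis
    using A_commute[OF nord_W[OF assms], of "fst x" "snd x" "fst y" "snd y" u] by auto
next
  case False
  then have "(if snd x + snd y = 0 then of_int (snd x) * form (fst x) (fst y) else 0) = 0"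
    by (cases "snd x = 0") auto
  then show ?thesis
    using A_commute[OF assms, of "fst x" "snd x" "fst y" "snd y"] False by simp
qed

lemma nord_swap_append:
  assumes "v \<in> W"
  shows "nord (u @ x # y # u') v = nord (u @ y # x # u') v"
  using assms
proof (induction u arbitrary: v)
  case Nil
  show ?case unfolding append_Nil using nord_swap[OF Nil] .
qed (simp add: A_W)

lemma nord_add_entry:
  "nord (u @ (a + b, k) # u') v = nord (u @ (a, k) # u') v + nord (u @ (b, k) # u') v"
  by (induction u arbitrary: v) (simp_all add: A_add A_add_left nord_add)

lemma nord_scale_entry: "nord (u @ (scale c a, k) # u') v = c *v nord (u @ (a, k) # u') v"
  by (induction u arbitrary: v) (simp_all add: A_scale A_scale_left nord_scale)

lemma bounded_tuples_split:
  assumes "ks \<in> bounded_tuples N (length (u @ x # w)) s"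
  obtains ks1 k ks2 where "ks = ks1 @ k # ks2" "length ks1 = length u" "length ks2 = length w"
proof
  have "length u < length ks" using assms by (simp add: bounded_tuples_def)
  then show "ks = take (length u) ks @ ks ! length u # drop (Suc (length u)) ks"
    by (rule id_take_nth_drop)
  show "length (take (length u) ks) = length u" "length (drop (Suc (length u)) ks) = length w"
    using assms by (simp_all add: bounded_tuples_def)
qed

lemma mode_add_entry:
  "mode N (u @ (a + b, n) # w) m v = mode N (u @ (a, n) # w) m v + mode N (u @ (b, n) # w) m v"
proof -
  define I where "I = bounded_tuples N (length (u @ (b, n) # w))
    (m + 1 - (\<Sum>(a, n)\<leftarrow>u @ (b, n) # w. int n + 1))"
  have I: "bounded_tuples N (length (u @ (a, n) # w))
    (m + 1 - (\<Sum>(a, n)\<leftarrow>u @ (a, n) # w. int n + 1)) = I" for a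
    by (simp add: I_def)
  show ?thesis
    unfolding mode_def I sum.distrib[symmetric]
  proof (rule sum.cong)
    fix ks
    assume "ks \<in> I"
    then have "ks \<in> bounded_tuples N (length (u @ (b, n) # w))
      (m + 1 - (\<Sum>(a, n)\<leftarrow>u @ (b, n) # w. int n + 1))" by (simp only: I_def)
    then obtain ks1 k ks2
      where "ks = ks1 @ k # ks2" "length ks1 = length u" "length ks2 = length w"
      by (rule bounded_tuples_split)
    then show "prod_apply (map (mode_coeff \<circ> snd) (u @ (a + b, n) # w)) ks
        *v nord (zip (map fst (u @ (a + b, n) # w)) ks) v
      = prod_apply (map (mode_coeff \<circ> snd) (u @ (a, n) # w)) ks
        *v nord (zip (map fst (u @ (a, n) # w)) ks) v
      + prod_apply (map (mode_coeff \<circ> snd) (u @ (b, n) # w)) ks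
        *v nord (zip (map fst (u @ (b, n) # w)) ks) v"
      by (simp add: nord_add_entry V.scale_right_distrib)
  qed simp
qed

lemma mode_scale_entry: "mode N (u @ (scale c a, n) # w) m v = c *v mode N (u @ (a, n) # w) m v"
  unfolding mode_def V.scale_sum_right
proof (rule sum.cong)
  fix ks
  assume "ks \<in> bounded_tuples N (length (u @ (a, n) # w))
    (m + 1 - (\<Sum>(a, n)\<leftarrow>u @ (a, n) # w. int n + 1))"
  then obtain ks1 k ks2 where "ks = ks1 @ k # ks2" "length ks1 = length u" "length ks2 = length w"
    by (rule bounded_tuples_split)
  then show "prod_apply (map (mode_coeff \<circ> snd) (u @ (scale c a, n) # w)) ks
      *v nord (zip (map fst (u @ (scale c a, n) # w)) ks) v
    = c *v prod_apply (map (mode_coeff \<circ> snd) (u @ (a, n) # w)) ks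
      *v nord (zip (map fst (u @ (a, n) # w)) ks) v"
    by (simp add: nord_scale_entry mult.commute)
qed simp

lemma mode_swap:
  assumes "v \<in> W"
  shows "mode N (u @ x # y # w) m v = mode N (u @ y # x # w) m v"
proof -
  \<comment> \<open>Summation indices are matched by exchanging the entries at the positions of \<open>x\<close> and \<open>y\<close>.\<close>
  let ?sw = "\<lambda>ks. take (length u) ks @ ks ! Suc (length u) # ks ! length u # drop (Suc (Suc (length u))) ks"
  have split: "\<exists>ks1 k l ks2. ks = ks1 @ k # l # ks2 \<and> length ks1 = length u \<and> length ks2 = length w"
    if ks: "ks \<in> bounded_tuples N (length (u @ x # y # w)) s" for ks :: "int list" and x y s
  proof -
    obtain ks1 k ks2 where 1: "ks = ks1 @ k # ks2" "length ks1 = length u" "length ks2 = length (y # w)"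
      using ks by (rule bounded_tuples_split)
    then obtain l ks3 where "ks2 = l # ks3" by (cases ks2) auto
    then show ?thesis using 1 by auto
  qed
  have sw: "?sw (ks1 @ k # l # ks2) = ks1 @ l # k # ks2" if "length ks1 = length u"
    for ks1 ks2 :: "int list" and k l
    using that by (simp add: nth_append)
  have sw_in: "?sw ks \<in> bounded_tuples N (length (u @ y # x # w)) s" and sw_sw: "?sw (?sw ks) = ks"
    if ks: "ks \<in> bounded_tuples N (length (u @ x # y # w)) s" for ks :: "int list" and x y s
  proof -
    from split[OF ks] obtain ks1 k l ks2 where d: "ks = ks1 @ k # l # ks2" "length ks1 = length u"
      by blast
    show "?sw ks \<in> bounded_tuples N (length (u @ y # x # w)) s"
      using ks unfolding d(1) sw[OF d(2)] by (auto simp: bounded_tuples_def)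
    show "?sw (?sw ks) = ks" unfolding d(1) sw[OF d(2)] ..
  qed
  define s where "s = m + 1 - (\<Sum>(a, n)\<leftarrow>u @ x # y # w. int n + 1)"
  have s': "m + 1 - (\<Sum>(a, n)\<leftarrow>u @ y # x # w. int n + 1) = s" by (simp add: s_def)
  show ?thesis
    unfolding mode_def s' s_def[symmetric]
  proof (rule sum.reindex_bij_witness[of _ ?sw ?sw])
    fix ks assume ks: "ks \<in> bounded_tuples N (length (u @ x # y # w)) s"
    from split[OF ks] obtain ks1 k l ks2 where d: "ks = ks1 @ k # l # ks2" "length ks1 = length u"
      "length ks2 = length w" by blast
    show "prod_apply (map (mode_coeff \<circ> snd) (u @ y # x # w)) (?sw ks)
        *v nord (zip (map fst (u @ y # x # w)) (?sw ks)) v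
      = prod_apply (map (mode_coeff \<circ> snd) (u @ x # y # w)) ks
        *v nord (zip (map fst (u @ x # y # w)) ks) v"
      unfolding d(1) sw[OF d(2)] using d(2,3)
      by (simp add: nord_swap_append[OF assms] mult_ac)
  qed (fact sw_in sw_sw)+
qed

end

section \<open>Linear maps out of the free algebra\<close>

interpretation free: vector_space free_scale
  by (rule vector_space_free_scale)

lemma lookup_free_scale [simp]:
  "Poly_Mapping.lookup (free_scale c p) w = c * Poly_Mapping.lookup p w"
  by (simp add: free_scale_def Poly_Mapping.map.rep_eq when_def)

lemma free_scale_single: "free_scale c (Poly_Mapping.single w d) = Poly_Mapping.single w (c * d)"
  by (rule poly_mapping_eqI) (simp add: lookup_single when_def)

lemma poly_mapping_sum_single:
  fixes p :: "'w \<Rightarrow>\<^sub>0 complex"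
  shows
  "p = (\<Sum>w\<in>Poly_Mapping.keys p. Poly_Mapping.single w (Poly_Mapping.lookup p w))"
  by (rule poly_mapping_eqI) (simp add: lookup_sum lookup_single when_def in_keys_iff)

lemma free_induct [case_names zero add single]:
  fixes p :: "'w \<Rightarrow>\<^sub>0 complex"
  assumes "P 0" "\<And>p q. P p \<Longrightarrow> P q \<Longrightarrow> P (p + q)" "\<And>w c. P (Poly_Mapping.single w c)"
  shows "P p"
proof -
  have "P (\<Sum>w\<in>I. Poly_Mapping.single w (Poly_Mapping.lookup p w))" for I
    by (induction I rule: infinite_finite_induct) (use assms in auto)
  from this[of "Poly_Mapping.keys p"] show ?thesis
    using poly_mapping_sum_single[of p] by simp
qed

definition linear_extension :: "(complex \<Rightarrow> 'v \<Rightarrow> 'v) \<Rightarrow> ('w \<Rightarrow> 'v) \<Rightarrow> ('w \<Rightarrow>\<^sub>0 complex) \<Rightarrow> 'v::ab_group_add"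
  where "linear_extension sv f p = (\<Sum>w\<in>Poly_Mapping.keys p. sv (Poly_Mapping.lookup p w) (f w))"

lemma linear_extension_superset:
  assumes "vector_space sv" "finite I" "Poly_Mapping.keys p \<subseteq> I"
  shows "linear_extension sv f p = (\<Sum>w\<in>I. sv (Poly_Mapping.lookup p w) (f w))"
proof -
  interpret V: vector_space sv by fact
  show ?thesis
    unfolding linear_extension_def using assms(2,3)
    by (intro sum.mono_neutral_left) (auto simp: in_keys_iff)
qed

lemma linear_extend:
  assumes "vector_space sv"
  shows "Vector_Spaces.linear free_scale sv (linear_extension sv f)"
proof -
  interpret V: vector_space sv by fact
  have "linear_extension sv f (p + q) = linear_extension sv f p + linear_extension sv f q" for p q
    using linear_extension_superset[OF assms, of "Poly_Mapping.keys p \<union> Poly_Mapping.keys q"]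
      Poly_Mapping.keys_add[of p q]
    by (simp add: lookup_add V.scale_left_distrib sum.distrib)
  moreover have "linear_extension sv f (free_scale c p) = sv c (linear_extension sv f p)" for c p
    using linear_extension_superset[OF assms, of "Poly_Mapping.keys p" "free_scale c p" f]
    by (simp add: linear_extension_def V.scale_sum_right subset_iff in_keys_iff)
  ultimately show ?thesis
    by (simp add: Vector_Spaces.linear_iff assms free.vector_space_axioms)
qed

lemma linear_extension_add: "vector_space sv \<Longrightarrow> linear_extension sv f (p + q) = linear_extension sv f p + linear_extension sv f q"
  using linear_extend[of sv f] by (simp add: Vector_Spaces.linear_iff)

lemma linear_extension_single:
  assumes "vector_space sv"
  shows "linear_extension sv f (Poly_Mapping.single w c) = sv c (f w)"
  using linear_extension_superset[OF assms, of "{w}" "Poly_Mapping.single w c"] by simp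

lemma linear_extension_sum:
  assumes "vector_space sv"
  shows "linear_extension sv f (sum p I) = (\<Sum>i\<in>I. linear_extension sv f (p i))"
proof (induction I rule: infinite_finite_induct)
  case (infinite I)
  then show ?case by (simp add: linear_extension_def)
next
  case empty
  show ?case by (simp add: linear_extension_def)
next
  case (insert i I)
  then show ?case by (simp add: linear_extension_add[OF assms])
qed

lemma push_words_extend: "push_words f = linear_extension free_scale (\<lambda>w. Poly_Mapping.single (f w) 1)"
  by (rule ext) (simp add: push_words_def linear_extension_def free_scale_single)

lemma linear_push_words: "Vector_Spaces.linear free_scale free_scale (push_words f)"
  unfolding push_words_extend by (rule linear_extend[OF free.vector_space_axioms])

lemma push_words_add: "push_words f (p + q) = push_words f p + push_words f q"
  and push_words_scale: "push_words f (free_scale c p) = free_scale c (push_words f p)"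
  using linear_push_words[of f] by (simp_all add: Vector_Spaces.linear_iff)

lemma push_words_diff: "push_words f (p - q) = push_words f p - push_words f q"
  using push_words_add[of f "p - q" q] by (simp add: algebra_simps)

lemma push_words_zero [simp]: "push_words f 0 = 0"
  by (simp add: push_words_def)

lemma push_words_sum: "push_words f (sum p I) = (\<Sum>i\<in>I. push_words f (p i))"
  by (induction I rule: infinite_finite_induct) (simp_all add: push_words_add)

lemma push_words_single [simp]:
  "push_words f (Poly_Mapping.single w c) = Poly_Mapping.single (f w) c"
  unfolding push_words_extend by (simp add: linear_extension_single free.vector_space_axioms free_scale_single)

section \<open>Symmetric functionals on the free algebra\<close>

context heisenberg_space
begin

definition nonneg_part :: "(int \<Rightarrow>\<^sub>0 'h) \<Rightarrow> (nat \<Rightarrow>\<^sub>0 'h)" where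
  "nonneg_part y = Poly_Mapping.map_key int y"

lemma lookup_nonneg_part [simp]:
  "Poly_Mapping.lookup (nonneg_part y) n = Poly_Mapping.lookup y (int n)"
  by (simp add: nonneg_part_def map_key.rep_eq)

lemma lookup_loop_scale [simp]:
  "Poly_Mapping.lookup (loop_scale c x) k = scale c (Poly_Mapping.lookup x k)"
  by (simp add: loop_scale_def Poly_Mapping.map.rep_eq when_def)

lemma nonneg_part_add: "nonneg_part (x + y) = nonneg_part x + nonneg_part y"
  by (rule poly_mapping_eqI) (simp add: lookup_add)

lemma nonneg_part_scale: "nonneg_part (loop_scale c x) = loop_scale c (nonneg_part x)"
  by (rule poly_mapping_eqI) simp

lemma nonneg_part_zero [simp]: "nonneg_part 0 = 0"
  by (rule poly_mapping_eqI) simp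

lemma lookup_of_nonneg:
  "Poly_Mapping.lookup (fst (of_nonneg x)) k = (if k < 0 then 0 else Poly_Mapping.lookup x (nat k))"
proof -
  have "Poly_Mapping.lookup (fst (of_nonneg x)) k
      = (\<Sum>n\<in>Poly_Mapping.keys x. if n = nat k \<and> \<not> k < 0 then Poly_Mapping.lookup x n else 0)"
    unfolding of_nonneg_def by (auto simp: lookup_sum lookup_single when_def intro!: sum.cong)
  also have "\<dots> = (if k < 0 then 0 else Poly_Mapping.lookup x (nat k))"
    by (auto simp: in_keys_iff)
  finally show ?thesis .
qed

lemma nonneg_part_of_nonneg: "nonneg_part (fst (of_nonneg x)) = x"
  by (rule poly_mapping_eqI) (simp add: lookup_of_nonneg)

end

text \<open>
  Symmetric multilinear functions of lists of pairs \<open>(a, n)\<close> are the linear maps out of the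
  symmetric algebra of \<open>\<hh> \<otimes> t\<^sup>-\<^sup>1 \<complex>[t\<^sup>-\<^sup>1]\<close>, the polynomial model of \<open>M(1, lam)\<close>, with \<open>(a, n)\<close>
  standing for \<open>a(-n-1)\<close>. The transposed action of the Heisenberg algebra on these functionals is
  explicit. It shows that each of them gives a linear map on the free algebra which vanishes on the
  relations of \<open>M(1, lam)\<close>. In this way the needed half of the Poincare-Birkhoff-Witt theorem, the
  independence of the monomials, is obtained without bases or ordered monomials.
\<close>

locale symmetric_functionals = heisenberg_space scale form + V: vector_space sv
  for scale :: "complex \<Rightarrow> 'h::ab_group_add \<Rightarrow> 'h"
    and form :: "'h \<Rightarrow> 'h \<Rightarrow> complex"
    and sv :: "complex \<Rightarrow> 'v::ab_group_add \<Rightarrow> 'v" (infixr "*v" 75) +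
  fixes lam :: "(nat \<Rightarrow>\<^sub>0 'h) \<Rightarrow> complex"
  assumes lam_add: "lam (x + y) = lam x + lam y"
    and lam_scale: "lam (loop_scale c x) = c * lam x"
begin

lemma lam_zero [simp]: "lam 0 = 0"
  using lam_add[of 0 0] by simp

definition sym_multilinear :: "(('h \<times> nat) list \<Rightarrow> 'v) \<Rightarrow> bool" where
  "sym_multilinear t \<longleftrightarrow>
     (\<forall>u a b n w. t (u @ (a + b, n) # w) = t (u @ (a, n) # w) + t (u @ (b, n) # w)) \<and>
     (\<forall>u c a n w. t (u @ (scale c a, n) # w) = c *v t (u @ (a, n) # w)) \<and>
     (\<forall>u x y w. t (u @ x # y # w) = t (u @ y # x # w))"

lemma sym_multilinearD:
  assumes "sym_multilinear t"
  shows "t (u @ (a + b, n) # w) = t (u @ (a, n) # w) + t (u @ (b, n) # w)"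
    and "t (u @ (scale c a, n) # w) = c *v t (u @ (a, n) # w)"
    and "t (u @ x # y # w) = t (u @ y # x # w)"
  using assms unfolding sym_multilinear_def by blast+

lemma sym_multilinear_Cons: "sym_multilinear t \<Longrightarrow> sym_multilinear (\<lambda>w. t (p # w))"
  unfolding sym_multilinear_def by (metis append_Cons)

lemma sym_multilinear_head:
  assumes "sym_multilinear t"
  shows "t ((a + b, n) # w) = t ((a, n) # w) + t ((b, n) # w)"
    and "t ((scale c a, n) # w) = c *v t ((a, n) # w)"
    and "t (x # y # w) = t (y # x # w)"
    and "t ((0, n) # w) = 0"
proof -
  show "t ((a + b, n) # w) = t ((a, n) # w) + t ((b, n) # w)"
    "t ((scale c a, n) # w) = c *v t ((a, n) # w)"
    using sym_multilinearD(1,2)[OF assms, of "[]"] by (simp_all only: append_Nil)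
  show "t (x # y # w) = t (y # x # w)" 
    using sym_multilinearD(3)[OF assms, of "[]" x y w] by (simp only: append_Nil)
  show "t ((0, n) # w) = 0"
    using sym_multilinearD(2)[OF assms, of "[]" 0 0 n w] by simp
qed

text \<open>
  The transposes of the derivations \<open>a(n)\<close>, \<open>n > 0\<close>, and of the multiplications \<open>a(n)\<close>, \<open>n < 0\<close>. An
  annihilation operator contracts with each letter of the list in turn.
\<close>

primrec contract :: "(int \<Rightarrow>\<^sub>0 'h) \<Rightarrow> (('h \<times> nat) list \<Rightarrow> 'v) \<Rightarrow> ('h \<times> nat) list \<Rightarrow> 'v" where
  "contract y t [] = 0"
| "contract y t (p # w) =
     (of_nat (Suc (snd p)) * form (Poly_Mapping.lookup y (int (Suc (snd p)))) (fst p)) *v t w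
     + contract y (\<lambda>w. t (p # w)) w"

definition create :: "(int \<Rightarrow>\<^sub>0 'h) \<Rightarrow> (('h \<times> nat) list \<Rightarrow> 'v) \<Rightarrow> ('h \<times> nat) list \<Rightarrow> 'v" where
  "create y t w = (\<Sum>k | k \<in> Poly_Mapping.keys y \<and> k < 0.
     t ((Poly_Mapping.lookup y k, nat (- k - 1)) # w))"

definition dual_act :: "'h heis \<Rightarrow> (('h \<times> nat) list \<Rightarrow> 'v) \<Rightarrow> ('h \<times> nat) list \<Rightarrow> 'v" where
  "dual_act x t w = create (fst x) t w + contract (fst x) t w
     + (lam (nonneg_part (fst x)) + snd x) *v t w"

lemma contract_add: "contract y (\<lambda>w. s w + t w) w = contract y s w + contract y t w"
  by (induction w arbitrary: s t) (simp_all add: V.scale_right_distrib del: of_nat_Suc)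

lemma contract_scale: "contract y (\<lambda>w. c *v t w) w = c *v contract y t w"
  by (induction w arbitrary: t)
     (simp_all add: V.scale_right_distrib mult.commute del: of_nat_Suc)

lemma contract_zero: "contract y (\<lambda>w. 0) w = 0"
  by (induction w) simp_all

lemma contract_sum: "contract y (\<lambda>w. \<Sum>i\<in>I. t i w) w = (\<Sum>i\<in>I. contract y (t i) w)"
  by (induction I rule: infinite_finite_induct) (simp_all add: contract_add contract_zero)

lemma contract_add_left: "contract (x + y) t w = contract x t w + contract y t w"
  by (induction w arbitrary: t)
     (simp_all add: lookup_add form_add_left V.scale_left_distrib distrib_left del: of_nat_Suc)

lemma contract_scale_left: "contract (loop_scale c x) t w = c *v contract x t w"
  by (induction w arbitrary: t)
     (simp_all add: form_scale_left V.scale_right_distrib mult.left_commute del: of_nat_Suc)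

lemma contract_zero_left [simp]: "contract 0 t w = 0"
  by (induction w arbitrary: t) simp_all

lemma contract_commute: "contract x (contract y t) w = contract y (contract x t) w"
proof (induction w arbitrary: t)
  case (Cons p w)
  show ?case
    by (simp add: contract_add contract_scale Cons algebra_simps del: of_nat_Suc)
qed simp

lemma sym_multilinear_contract:
  assumes "sym_multilinear t"
  shows "sym_multilinear (contract y t)"
proof -
  have 1: "contract y t (u @ (a + b, n) # w)
      = contract y t (u @ (a, n) # w) + contract y t (u @ (b, n) # w)" for u a b n w
    using assms
  proof (induction u arbitrary: t)
    case Nil
    then show ?case
      by (simp add: form_add_right V.scale_left_distrib distrib_left sym_multilinear_head(1)
          contract_add algebra_simps del: of_nat_Suc)
  next
    case (Cons p u)
    then show ?case using Cons.IH[OF sym_multilinear_Cons[OF Cons.prems]]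
      by (simp add: sym_multilinearD(1) algebra_simps del: of_nat_Suc)
  qed
  have 2: "contract y t (u @ (scale c a, n) # w) = c *v contract y t (u @ (a, n) # w)" for u c a n w
    using assms
  proof (induction u arbitrary: t)
    case Nil
    then show ?case
      by (simp add: form_scale_right V.scale_right_distrib mult_ac sym_multilinear_head(2)
          contract_scale del: of_nat_Suc)
  next
    case (Cons p u)
    then show ?case using Cons.IH[OF sym_multilinear_Cons[OF Cons.prems]]
      by (simp add: sym_multilinearD(2) V.scale_right_distrib mult_ac del: of_nat_Suc)
  qed
  have 3: "contract y t (u @ p # q # w) = contract y t (u @ q # p # w)" for u p q w
    using assms
  proof (induction u arbitrary: t)
    case Nil
    have "(\<lambda>w. t (p # q # w)) = (\<lambda>w. t (q # p # w))"
      using sym_multilinear_head(3)[OF Nil] by blast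
    then show ?case by (simp add: algebra_simps del: of_nat_Suc)
  next
    case (Cons r u)
    then show ?case using Cons.IH[OF sym_multilinear_Cons[OF Cons.prems]]
      by (simp add: sym_multilinearD(3)[OF Cons.prems, of u p q w] del: of_nat_Suc)
  qed
  show ?thesis unfolding sym_multilinear_def using 1 2 3 by blast
qed

lemma create_superset:
  assumes "sym_multilinear t" "finite I" "Poly_Mapping.keys y \<subseteq> I"
  shows "create y t w =
    (\<Sum>k | k \<in> I \<and> k < 0. t ((Poly_Mapping.lookup y k, nat (- k - 1)) # w))"
  unfolding create_def using assms
  by (intro sum.mono_neutral_left) (auto simp: in_keys_iff sym_multilinear_head(4))

lemma create_add_left:
  assumes "sym_multilinear t"
  shows "create (x + y) t w = create x t w + create y t w"
proof -
  let ?I = "Poly_Mapping.keys x \<union> Poly_Mapping.keys y"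
  have "finite ?I" "Poly_Mapping.keys (x + y) \<subseteq> ?I" by (simp_all add: Poly_Mapping.keys_add)
  then show ?thesis
    using create_superset[OF assms, of ?I]
    by (simp add: lookup_add sym_multilinear_head(1)[OF assms] sum.distrib)
qed

lemma create_scale_left:
  assumes "sym_multilinear t"
  shows "create (loop_scale c x) t w = c *v create x t w"
proof -
  have "Poly_Mapping.keys (loop_scale c x) \<subseteq> Poly_Mapping.keys x" by (auto simp: in_keys_iff)
  then show ?thesis
    using create_superset[OF assms, of "Poly_Mapping.keys x"]
    by (simp add: sym_multilinear_head(2)[OF assms] V.scale_sum_right)
qed

lemma create_zero_left [simp]: "create 0 t w = 0"
  by (simp add: create_def)

lemma create_add: "create y (\<lambda>w. s w + t w) w = create y s w + create y t w"
  by (simp add: create_def sum.distrib)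

lemma create_scale: "create y (\<lambda>w. c *v t w) w = c *v create y t w"
  by (simp add: create_def V.scale_sum_right)

lemma sym_multilinear_create:
  assumes "sym_multilinear t"
  shows "sym_multilinear (create y t)"
proof -
  note * = sym_multilinearD[OF sym_multilinear_Cons[OF assms]]
  show ?thesis
    unfolding sym_multilinear_def create_def
    by (auto simp: *(1,2) sum.distrib V.scale_sum_right intro!: sum.cong *(3))
qed

lemma sym_multilinear_dual_act:
  assumes "sym_multilinear t"
  shows "sym_multilinear (dual_act x t)"
  unfolding sym_multilinear_def dual_act_def
  using sym_multilinearD[OF sym_multilinear_create[OF assms]]
    sym_multilinearD[OF sym_multilinear_contract[OF assms]] sym_multilinearD[OF assms]
  by (auto simp: V.scale_right_distrib mult_ac algebra_simps)

lemma create_commute: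
  assumes "sym_multilinear t"
  shows "create x (create y t) w = create y (create x t) w"
  unfolding create_def
  by (subst sum.swap) (intro sum.cong refl sym_multilinear_head(3)[OF assms])

text \<open>
  Annihilation operators obey the Leibniz rule: the extra term is the contraction with the new letter.
\<close>

lemma contract_create:
  "contract y (create x t) w = create x (contract y t) w
    + (\<Sum>k | k \<in> Poly_Mapping.keys x \<and> k < 0.
        of_int k * form (Poly_Mapping.lookup x k) (Poly_Mapping.lookup y (- k))) *v t w"
proof -
  let ?I = "{k \<in> Poly_Mapping.keys x. k < 0}"
  have "create x (contract y t) w
      = (\<Sum>k\<in>?I. (- (of_int k * form (Poly_Mapping.lookup x k) (Poly_Mapping.lookup y (- k)))) *v t w)
        + contract y (create x t) w"
    unfolding create_def contract_sum sum.distrib[symmetric]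
  proof (intro sum.cong refl)
    fix k assume "k \<in> ?I"
    then have k: "int (Suc (nat (- k - 1))) = - k" "of_nat (Suc (nat (- k - 1))) = (- of_int k :: complex)"
      by auto
    show "contract y t ((Poly_Mapping.lookup x k, nat (- k - 1)) # w)
      = - (of_int k * form (Poly_Mapping.lookup x k) (Poly_Mapping.lookup y (- k))) *v t w
        + contract y (\<lambda>w. t ((Poly_Mapping.lookup x k, nat (- k - 1)) # w)) w"
      by (simp only: contract.simps fst_conv snd_conv k) (simp add: form_symmetric)
  qed
  then show ?thesis
    by (simp add: V.scale_sum_left sum_negf)
qed

text \<open>
  The order of the factors is reversed because the action is transposed. Creation operators commute by
  symmetry of \<open>t\<close> and contractions commute with each other, so that the bracket comes from the two
  mixed terms: indices \<open>k < 0\<close> from one of them and \<open>k > 0\<close> from the other.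
\<close>

lemma dual_act_commute:
  assumes t: "sym_multilinear t"
  shows "dual_act y (dual_act x t) w
    = dual_act x (dual_act y t) w + dual_act (bracket x y) t w"
proof -
  define X where "X = fst x"
  define Y where "Y = fst y"
  define f where "f k = of_int k * form (Poly_Mapping.lookup X k) (Poly_Mapping.lookup Y (- k))" for k
  have neg: "(\<Sum>k | k \<in> Poly_Mapping.keys X \<and> k < 0. f k) = (\<Sum>k | k \<in> Poly_Mapping.keys X \<and> k < 0.
        of_int k * form (Poly_Mapping.lookup X k) (Poly_Mapping.lookup Y (- k)))"
    by (simp add: f_def)
  have "(\<Sum>k | k \<in> Poly_Mapping.keys Y \<and> k < 0.
        of_int k * form (Poly_Mapping.lookup Y k) (Poly_Mapping.lookup X (- k)))
      = (\<Sum>k | - k \<in> Poly_Mapping.keys Y \<and> 0 < k. - f k)"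
    by (rule sum.reindex_bij_witness[of _ uminus uminus]) (auto simp: f_def form_symmetric)
  also have "\<dots> = (\<Sum>k | k \<in> Poly_Mapping.keys X \<and> 0 < k. - f k)"
  proof (rule sum.mono_neutral_cong)
    have "{k. - k \<in> Poly_Mapping.keys Y \<and> 0 < k} \<subseteq> uminus ` Poly_Mapping.keys Y" by force
    then show "finite {k. - k \<in> Poly_Mapping.keys Y \<and> 0 < k}"
      by (rule finite_subset) simp
  qed (auto simp: f_def in_keys_iff)
  finally have pos: "(\<Sum>k | k \<in> Poly_Mapping.keys Y \<and> k < 0.
        of_int k * form (Poly_Mapping.lookup Y k) (Poly_Mapping.lookup X (- k)))
      = - (\<Sum>k | k \<in> Poly_Mapping.keys X \<and> 0 < k. f k)" by (simp add: sum_negf)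
  have "(\<Sum>k\<in>Poly_Mapping.keys X. f k)
      = (\<Sum>k\<in>{k \<in> Poly_Mapping.keys X. k < 0} \<union> {k \<in> Poly_Mapping.keys X. 0 < k}. f k)"
    by (rule sum.mono_neutral_right) (auto simp: f_def not_less)
  also have "\<dots> = (\<Sum>k | k \<in> Poly_Mapping.keys X \<and> k < 0. f k) + (\<Sum>k | k \<in> Poly_Mapping.keys X \<and> 0 < k. f k)"
    by (rule sum.union_disjoint) auto
  finally have br: "snd (bracket x y)
      = (\<Sum>k | k \<in> Poly_Mapping.keys X \<and> k < 0. f k) + (\<Sum>k | k \<in> Poly_Mapping.keys X \<and> 0 < k. f k)"
    by (simp add: bracket_def f_def X_def Y_def)
  have dual: "dual_act z s = (\<lambda>w. (create (fst z) s w + contract (fst z) s w)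
     + (lam (nonneg_part (fst z)) + snd z) *v s w)" for z s
    by (rule ext) (simp add: dual_act_def)
  have YX: "dual_act y (dual_act x t) w = create Y (create X t) w + create Y (contract X t) w
      + contract Y (create X t) w + contract Y (contract X t) w
      + (lam (nonneg_part X) + snd x) *v (create Y t w + contract Y t w)
      + (lam (nonneg_part Y) + snd y) *v (create X t w + contract X t w)
      + ((lam (nonneg_part Y) + snd y) * (lam (nonneg_part X) + snd x)) *v t w"
    unfolding dual create_add contract_add create_scale contract_scale X_def Y_def
    by (simp add: V.scale_right_distrib algebra_simps)
  have XY: "dual_act x (dual_act y t) w = create X (create Y t) w + create X (contract Y t) w
      + contract X (create Y t) w + contract X (contract Y t) w
      + (lam (nonneg_part Y) + snd y) *v (create X t w + contract X t w)
      + (lam (nonneg_part X) + snd x) *v (create Y t w + contract Y t w)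
      + ((lam (nonneg_part Y) + snd y) * (lam (nonneg_part X) + snd x)) *v t w"
    unfolding dual create_add contract_add create_scale contract_scale X_def Y_def
    by (simp add: V.scale_right_distrib algebra_simps)
  have "dual_act (bracket x y) t w = snd (bracket x y) *v t w"
    by (simp add: dual_act_def bracket_def)
  then show ?thesis
    unfolding YX XY contract_create[of Y X] contract_create[of X Y] neg[symmetric] pos br
      create_commute[OF t, of Y X] contract_commute[of Y X]
    by (simp add: V.scale_left_distrib algebra_simps)
qed

lemma fold_dual_act_sym_multilinear:
  "sym_multilinear t \<Longrightarrow> sym_multilinear (fold dual_act u t)"
  by (induction u arbitrary: t) (simp_all add: sym_multilinear_dual_act)

lemma fold_dual_act_add:
  "fold dual_act u (\<lambda>w. s w + t w) = (\<lambda>w. fold dual_act u s w + fold dual_act u t w)"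
proof (induction u arbitrary: s t)
  case (Cons x u)
  have "dual_act x (\<lambda>w. s w + t w) = (\<lambda>w. dual_act x s w + dual_act x t w)"
    by (rule ext) (simp add: dual_act_def create_add contract_add algebra_simps)
  then show ?case by (simp add: Cons)
qed simp

lemma fold_dual_act_scale:
  "fold dual_act u (\<lambda>w. c *v t w) = (\<lambda>w. c *v fold dual_act u t w)"
proof (induction u arbitrary: t)
  case (Cons x u)
  have "dual_act x (\<lambda>w. c *v t w) = (\<lambda>w. c *v dual_act x t w)"
    by (rule ext) (simp add: dual_act_def create_scale contract_scale V.scale_right_distrib mult.commute)
  then show ?case by (simp add: Cons)
qed simp

definition dual_eval :: "(('h \<times> nat) list \<Rightarrow> 'v) \<Rightarrow> 'h free_alg \<Rightarrow> 'v" where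
  "dual_eval t = linear_extension sv (\<lambda>u. fold dual_act u t [])"

lemma dual_eval_linear: "Vector_Spaces.linear free_scale sv (dual_eval t)"
  unfolding dual_eval_def by (rule linear_extend[OF V.vector_space_axioms])

lemma dual_eval_add: "dual_eval t (p + q) = dual_eval t p + dual_eval t q"
  unfolding dual_eval_def by (rule linear_extension_add[OF V.vector_space_axioms])

lemma dual_eval_single: "dual_eval t (Poly_Mapping.single u c) = c *v fold dual_act u t []"
  unfolding dual_eval_def by (rule linear_extension_single[OF V.vector_space_axioms])

text \<open>
  The relations of the enveloping algebra hold by linearity and by the commutator formula. At the right
  end of a word the functional is evaluated at the empty list. There contractions vanish, so that
  \<open>x\<close> and \<open>K\<close> act by \<open>lam x\<close> and \<open>1\<close>.
\<close>

theorem dual_eval_kernel: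
  assumes t: "sym_multilinear t" and p: "p \<in> whittaker_kernel lam"
  shows "dual_eval t p = 0"
proof -
  interpret dual_eval: Vector_Spaces.linear free_scale sv "dual_eval t" by (rule dual_eval_linear)
  have split: "fold dual_act (u @ x # v) t = fold dual_act v (dual_act x (fold dual_act u t))" for u x v
    by simp
  have env: "dual_eval t r = 0" if "r \<in> env_relations" for r
  proof -
    show ?thesis
      using that unfolding env_relations_def
    proof (elim UnE CollectE exE conjE)
      fix u v x y
      assume 1: "r = Poly_Mapping.single (u @ [x + y] @ v) 1
        - Poly_Mapping.single (u @ [x] @ v) 1 - Poly_Mapping.single (u @ [y] @ v) 1"
      let ?s = "fold dual_act u t"
      have s: "sym_multilinear ?s" by (rule fold_dual_act_sym_multilinear[OF t])
      have "dual_act (x + y) ?s = (\<lambda>w. dual_act x ?s w + dual_act y ?s w)"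
        by (rule ext) (simp add: dual_act_def create_add_left[OF s] contract_add_left
            nonneg_part_add lam_add algebra_simps)
      then show ?thesis
        by (simp add: 1 dual_eval.diff dual_eval_single fold_dual_act_add)
    next
      fix u v c x
      assume 2: "r = Poly_Mapping.single (u @ [heis_scale c x] @ v) 1
        - Poly_Mapping.single (u @ [x] @ v) c"
      let ?s = "fold dual_act u t"
      have s: "sym_multilinear ?s" by (rule fold_dual_act_sym_multilinear[OF t])
      have "dual_act (heis_scale c x) ?s = (\<lambda>w. c *v dual_act x ?s w)"
        by (rule ext) (simp add: heis_scale_def dual_act_def create_scale_left[OF s]
            contract_scale_left nonneg_part_scale lam_scale algebra_simps)
      then show ?thesis
        by (simp add: 2 dual_eval.diff dual_eval_single fold_dual_act_scale)
    next
      fix u v x y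
      assume 3: "r = Poly_Mapping.single (u @ [x, y] @ v) 1
        - Poly_Mapping.single (u @ [y, x] @ v) 1 - Poly_Mapping.single (u @ [bracket x y] @ v) 1"
      let ?s = "fold dual_act u t"
      have s: "sym_multilinear ?s" by (rule fold_dual_act_sym_multilinear[OF t])
      have "dual_act y (dual_act x ?s)
          = (\<lambda>w. dual_act x (dual_act y ?s) w + dual_act (bracket x y) ?s w)"
        by (rule ext) (rule dual_act_commute[OF s])
      then show ?thesis
        by (simp add: 3 dual_eval.diff dual_eval_single fold_dual_act_add)
    qed
  qed
  have whit: "dual_eval t r = 0" if "r \<in> whittaker_relations lam" for r
  proof -
    have "create (fst (of_nonneg x)) s w = 0" for x s w
      unfolding create_def by (rule sum.neutral) (auto simp: in_keys_iff lookup_of_nonneg)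
    then have nonneg: "dual_act (of_nonneg x) s [] = lam x *v s []" for x s
      by (simp add: dual_act_def nonneg_part_of_nonneg) (simp add: of_nonneg_def)
    have central: "dual_act central s [] = s []" for s
      by (simp add: dual_act_def central_def)
    show ?thesis
      using that unfolding whittaker_relations_def
      by (auto simp: dual_eval.diff dual_eval_single nonneg central)
  qed
  have "p \<in> free.span (env_relations \<union> whittaker_relations lam)"
    using p by (simp add: whittaker_kernel_def)
  then show ?thesis
    by (induction rule: free.span_induct_alt)
       (use env whit in \<open>auto simp: dual_eval.add dual_eval.scale\<close>)
qed

text \<open>
  On creation monomials the functional \<open>dual_eval t\<close> is \<open>t\<close> itself. So combinations of creation
  monomials that agree in \<open>M(1, lam)\<close> have the same image under every symmetric multilinear map.
\<close>

theorem creation_determines_functionals: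
  assumes t: "sym_multilinear t" and eq: "creation p - creation q \<in> whittaker_kernel lam"
  shows "linear_extension sv t p = linear_extension sv t q"
proof -
  have act: "dual_act (h_mode a (- int n - 1)) s = (\<lambda>w. s ((a, n) # w))"
    if s: "sym_multilinear s" for a :: 'h and n s
  proof (rule ext)
    fix w
    have "contract (Poly_Mapping.single (- int n - 1) a) s w = 0" for s w
      by (induction w arbitrary: s) (simp_all add: lookup_single del: of_nat_Suc)
    moreover have "create (Poly_Mapping.single (- int n - 1) a) s w = s ((a, n) # w)"
      using create_superset[OF s, of "{- int n - 1}" "Poly_Mapping.single (- int n - 1) a"]
      by (simp add: Collect_conv_if)
    moreover have "nonneg_part (Poly_Mapping.single (- int n - 1) a) = 0"
      by (rule poly_mapping_eqI) (simp add: lookup_single)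
    ultimately show "dual_act (h_mode a (- int n - 1)) s w = s ((a, n) # w)"
      by (simp add: dual_act_def h_mode_def)
  qed
  have word: "fold dual_act (map (\<lambda>(a, n). h_mode a (- int n - 1)) w) s [] = s w"
    if "sym_multilinear s" for s w
    using that by (induction w arbitrary: s) (auto simp: act sym_multilinear_Cons)
  have "dual_eval t (creation r) = linear_extension sv t r" for r
  proof (induction r rule: free_induct)
    case zero
    show ?case by (simp add: creation_def dual_eval_def linear_extension_def)
  qed (simp_all add: creation_def push_words_add dual_eval_add linear_extension_add dual_eval_single word[OF t]
         linear_extension_single V.vector_space_axioms)
  moreover have "dual_eval t (creation p) = dual_eval t (creation p - creation q) + dual_eval t (creation q)"
    by (simp flip: dual_eval_add)
  ultimately show ?thesis
    using dual_eval_kernel[OF t eq] by simp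
qed

end

context heisenberg_space
begin

text \<open>
  The functional that takes the constant term separates the vacuum from zero.
\<close>

lemma vacuum_not_in_kernel:
  assumes "\<And>x y. lam (x + y) = lam x + lam y" "\<And>c x. lam (loop_scale c x) = c * lam x"
  shows "Poly_Mapping.single [] 1 \<notin> whittaker_kernel lam"
proof
  interpret symmetric_functionals scale form "(*)" lam
    by unfold_locales (auto simp: assms algebra_simps)
  assume *: "Poly_Mapping.single [] 1 \<in> whittaker_kernel lam"
  have "sym_multilinear (\<lambda>w. if w = [] then 1 else 0)"
    by (auto simp: sym_multilinear_def)
  from dual_eval_kernel[OF this *] show False by (simp add: dual_eval_single)
qed

end

section \<open>The standard Whittaker module by normal forms\<close>

text \<open>
  The projection along \<open>K\<close> onto a complement, obtained by extending a basis of \<open>K\<close>.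
\<close>

lemma (in vector_space) projection_with_kernel:
  assumes K: "subspace K"
  obtains T where "\<forall>x y. T (x + y) = T x + T y" "\<forall>c x. T (scale c x) = scale c (T x)"
    "\<forall>x. T x = 0 \<longleftrightarrow> x \<in> K" "\<forall>x. T (T x) = T x"
proof -
  obtain B where B: "B \<subseteq> K" "independent B" "K \<subseteq> span B"
    by (rule maximal_independent_subset)
  obtain C where C: "B \<subseteq> C" "independent C" "UNIV \<subseteq> span C"
    using maximal_independent_subset_extend[OF subset_UNIV B(2)] by metis
  interpret pair: vector_space_pair scale scale by unfold_locales
  define T where "T = pair.construct C (\<lambda>b. if b \<in> B then 0 else b)"
  have lin: "T (x + y) = T x + T y" "T (scale c x) = scale c (T x)" for x y c
    using pair.linear_construct[OF C(2)] unfolding T_def by (simp_all add: Vector_Spaces.linear_iff)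
  have T_zero: "T 0 = 0" using lin(2)[of 0 0] by simp
  have T_base: "T b = (if b \<in> B then 0 else b)" if "b \<in> C" for b
    unfolding T_def by (rule pair.construct_basis[OF C(2) that])
  have diff: "T x - x \<in> K" for x
  proof -
    have "x \<in> span C" using C by blast
    then show ?thesis
    proof (induction rule: span_induct_alt)
      case base
      show ?case using K by (simp add: T_zero subspace_0)
    next
      case (step c x y)
      have x: "T x - x \<in> K"
        using T_base[OF step(1)] B(1) K by (auto intro: subspace_neg subspace_0)
      have "T (scale c x + y) - (scale c x + y) = scale c (T x - x) + (T y - y)"
        by (simp add: lin algebra_simps)
      then show ?case
        by (simp only: subspace_add[OF K subspace_scale[OF K x] step(2)])
    qed
  qed
  have ker: "T x = 0" if "x \<in> K" for x
  proof -
    have "x \<in> span B" using that B by blast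
    then show ?thesis
      by (induction rule: span_induct_alt) (use C(1) T_base in \<open>auto simp: lin T_zero\<close>)
  qed
  have T_diff: "T (x - y) = T x - T y" for x y
    using lin(1)[of "x - y" y] by simp
  have "T x = 0 \<longleftrightarrow> x \<in> K" for x
  proof
    assume "T x = 0"
    then have "- x \<in> K" using diff[of x] by simp
    from subspace_neg[OF K this] show "x \<in> K" by simp
  qed (rule ker)
  moreover have "T (T x) = T x" for x using ker[OF diff[of x]] by (simp add: T_diff)
  ultimately show thesis using lin by (intro that[of T]) simp_all
qed

context heisenberg_space
begin

lemma h_mode_add: "h_mode (a + b) k = h_mode a k + h_mode b k"
  by (simp add: h_mode_def single_add)

lemma loop_scale_single: "loop_scale c (Poly_Mapping.single k a) = Poly_Mapping.single k (scale c a)"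
  by (rule poly_mapping_eqI) (simp add: lookup_single when_def)

lemma h_mode_scale: "h_mode (scale c a) k = heis_scale c (h_mode a k)"
  by (simp add: h_mode_def heis_scale_def loop_scale_single)

lemma bracket_h_mode:
  "bracket (h_mode a j) (h_mode b k)
    = heis_scale (if j + k = 0 then of_int j * form a b else 0) central"
proof -
  have "(\<Sum>m\<in>Poly_Mapping.keys (Poly_Mapping.single j a). of_int m
        * form (Poly_Mapping.lookup (Poly_Mapping.single j a) m)
            (Poly_Mapping.lookup (Poly_Mapping.single k b) (- m)))
      = of_int j * form a (Poly_Mapping.lookup (Poly_Mapping.single k b) (- j))"
    by (cases "a = 0") simp_all
  moreover have "loop_scale c 0 = 0" for c by (rule poly_mapping_eqI) simp
  ultimately show ?thesis
    by (auto simp: bracket_def h_mode_def heis_scale_def central_def lookup_single when_def)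
qed

lemma h_mode_nonneg: "h_mode a (int n) = of_nonneg (Poly_Mapping.single n a)"
  by (cases "a = 0") (simp_all add: h_mode_def of_nonneg_def)

lemma heis_decomposition:
  "x = (\<Sum>k\<in>Poly_Mapping.keys (fst x). h_mode (Poly_Mapping.lookup (fst x) k) k)
     + heis_scale (snd x) central"
proof (rule prod_eqI)
  have "(\<Sum>k\<in>Poly_Mapping.keys (fst x). Poly_Mapping.single k (Poly_Mapping.lookup (fst x) k)) = fst x"
    by (rule poly_mapping_eqI) (simp add: lookup_sum lookup_single when_def in_keys_iff)
  moreover have "loop_scale c 0 = 0" for c by (rule poly_mapping_eqI) simp
  ultimately show "fst x = fst ((\<Sum>k\<in>Poly_Mapping.keys (fst x).
      h_mode (Poly_Mapping.lookup (fst x) k) k) + heis_scale (snd x) central)"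
    by (simp add: fst_sum h_mode_def heis_scale_def central_def)
  show "snd x = snd ((\<Sum>k\<in>Poly_Mapping.keys (fst x).
      h_mode (Poly_Mapping.lookup (fst x) k) k) + heis_scale (snd x) central)"
    by (simp add: snd_sum h_mode_def heis_scale_def central_def)
qed

lemma kernel_subspace: "free.subspace (whittaker_kernel lam)"
  by (simp add: whittaker_kernel_def)

lemma env_relation_in_kernel: "r \<in> env_relations \<Longrightarrow> r \<in> whittaker_kernel lam"
  and whittaker_relation_in_kernel: "r \<in> whittaker_relations lam \<Longrightarrow> r \<in> whittaker_kernel lam"
  by (simp_all add: whittaker_kernel_def free.span_base)

lemma push_words_kernel:
  assumes "\<And>r. r \<in> env_relations \<union> whittaker_relations lam \<Longrightarrow> push_words f r \<in> whittaker_kernel lam'"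
    and "p \<in> whittaker_kernel lam"
  shows "push_words f p \<in> whittaker_kernel lam'"
proof -
  have "p \<in> free.span (env_relations \<union> whittaker_relations lam)"
    using assms(2) by (simp add: whittaker_kernel_def)
  then show ?thesis
    by (induction rule: free.span_induct_alt)
       (use assms(1) kernel_subspace[of lam'] in
         \<open>auto simp: push_words_add push_words_scale free.subspace_0 free.subspace_add free.subspace_scale\<close>)
qed

lemma push_words_Cons_kernel:
  assumes "p \<in> whittaker_kernel lam"
  shows "push_words ((#) x) p \<in> whittaker_kernel lam"
proof (rule push_words_kernel[OF _ assms])
  fix r assume "r \<in> env_relations \<union> whittaker_relations lam"
  then show "push_words ((#) x) r \<in> whittaker_kernel lam"
  proof
    assume "r \<in> env_relations"
    then have "push_words ((#) x) r \<in> env_relations"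
      unfolding env_relations_def
    proof (elim UnE CollectE exE conjE, goal_cases)
      case (1 u v y z)
      then show ?case
        by (intro UnI1 CollectI exI[of _ "x # u"] exI[of _ v] exI[of _ y] exI[of _ z])
           (simp add: push_words_diff)
    next
      case (2 u v c y)
      then show ?case
        by (intro UnI1 UnI2 CollectI exI[of _ "x # u"] exI[of _ v] exI[of _ y] exI[of _ c])
           (simp add: push_words_diff)
    next
      case (3 u v y z)
      then show ?case
        by (intro UnI2 CollectI exI[of _ "x # u"] exI[of _ v] exI[of _ y] exI[of _ z])
           (simp add: push_words_diff)
    qed
    then show ?thesis by (rule env_relation_in_kernel)
  next
    assume "r \<in> whittaker_relations lam"
    then have "push_words ((#) x) r \<in> whittaker_relations lam"
      unfolding whittaker_relations_def
    proof (elim UnE CollectE exE conjE, goal_cases)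
      case (1 u y)
      then show ?case
        by (intro UnI1 CollectI exI[of _ "x # u"] exI[of _ y]) (simp add: push_words_diff)
    next
      case (2 u)
      then show ?case
        by (intro UnI2 CollectI exI[of _ "x # u"]) (simp add: push_words_diff)
    qed
    then show ?thesis by (rule whittaker_relation_in_kernel)
  qed
qed

lemma cls_eq_iff: "cls lam p = cls lam q \<longleftrightarrow> p - q \<in> whittaker_kernel lam"
proof
  assume "cls lam p = cls lam q"
  moreover have "p \<in> cls lam p"
    using kernel_subspace[of lam] by (simp add: cls_def free.subspace_0)
  ultimately show "p - q \<in> whittaker_kernel lam" by (simp add: cls_def)
next
  assume pq: "p - q \<in> whittaker_kernel lam"
  have "r - p \<in> whittaker_kernel lam \<longleftrightarrow> r - q \<in> whittaker_kernel lam" for r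
  proof
    assume "r - p \<in> whittaker_kernel lam"
    from free.subspace_add[OF kernel_subspace this pq] show "r - q \<in> whittaker_kernel lam" by simp
  next
    assume "r - q \<in> whittaker_kernel lam"
    from free.subspace_diff[OF kernel_subspace this pq] show "r - p \<in> whittaker_kernel lam" by simp
  qed
  then show "cls lam p = cls lam q" by (simp add: cls_def)
qed

lemma rep_cls: "rep (cls lam p) - p \<in> whittaker_kernel lam"
proof -
  have "p \<in> cls lam p"
    using kernel_subspace[of lam] by (simp add: cls_def free.subspace_0)
  then have "rep (cls lam p) \<in> cls lam p" unfolding rep_def by (rule someI)
  then show ?thesis by (simp add: cls_def)
qed

end

text \<open>
  A projection \<open>T\<close> of the free algebra with kernel \<open>whittaker_kernel lam\<close> selects a normal form in each
  coset. It identifies \<open>M(1, lam)\<close> with the range of \<open>T\<close>, where the vector space operations are those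
  of a type and the relations of the module hold as equations.
\<close>

locale whittaker_setting = heisenberg_space scale form
  for scale :: "complex \<Rightarrow> 'h::ab_group_add \<Rightarrow> 'h"
    and form :: "'h \<Rightarrow> 'h \<Rightarrow> complex" +
  fixes lam :: "(nat \<Rightarrow>\<^sub>0 'h) \<Rightarrow> complex"
    and B :: "'h set"
    and T :: "'h free_alg \<Rightarrow> 'h free_alg"
  assumes finite_basis: "finite B" "independent B" "span B = UNIV"
    and whittaker: "whittaker_function lam"
    and T_add: "T (p + q) = T p + T q"
    and T_scale: "T (free_scale c p) = free_scale c (T p)"
    and T_kernel: "T p = 0 \<longleftrightarrow> p \<in> whittaker_kernel lam"
    and T_idem: "T (T p) = T p"
begin

lemma lam_add: "lam (x + y) = lam x + lam y"
  and lam_scale: "lam (loop_scale c x) = c * lam x"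
  using whittaker unfolding whittaker_function_def by (simp_all add: Vector_Spaces.linear_iff)

lemma T_zero [simp]: "T 0 = 0"
  using T_scale[of 0 0] by simp

lemma T_diff: "T (p - q) = T p - T q"
  using T_add[of "p - q" q] by (simp add: algebra_simps)

lemma T_sum: "T (sum p I) = (\<Sum>i\<in>I. T (p i))"
  by (induction I rule: infinite_finite_induct) (simp_all add: T_add)

lemma T_eq_iff: "T p = T q \<longleftrightarrow> p - q \<in> whittaker_kernel lam"
  by (simp add: T_kernel[symmetric] T_diff)

lemma T_single: "T (Poly_Mapping.single w c) = free_scale c (T (Poly_Mapping.single w 1))"
  by (simp add: T_scale[symmetric] free_scale_single)

definition lie_act :: "'h heis \<Rightarrow> 'h free_alg \<Rightarrow> 'h free_alg" where
  "lie_act x p = T (push_words ((#) x) p)"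

lemma lie_act_T: "lie_act x (T p) = T (push_words ((#) x) p)"
  unfolding lie_act_def T_eq_iff push_words_diff[symmetric]
  by (rule push_words_Cons_kernel) (simp add: T_eq_iff[symmetric] T_idem)

lemma lie_act_add: "lie_act x (p + q) = lie_act x p + lie_act x q"
  and lie_act_scale: "lie_act x (free_scale c p) = free_scale c (lie_act x p)"
  by (simp_all add: lie_act_def push_words_add push_words_scale T_add T_scale)

lemma lie_act_zero [simp]: "lie_act x 0 = 0"
  by (simp add: lie_act_def)

lemma T_relations_zero:
  "r \<in> env_relations \<Longrightarrow> T r = 0" "r \<in> whittaker_relations lam \<Longrightarrow> T r = 0"
  by (simp_all add: T_kernel env_relation_in_kernel whittaker_relation_in_kernel)

lemma T_env:
  "T (Poly_Mapping.single (u @ (x + y) # v) 1)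
    = T (Poly_Mapping.single (u @ x # v) 1) + T (Poly_Mapping.single (u @ y # v) 1)"
  "T (Poly_Mapping.single (u @ heis_scale c x # v) 1)
    = free_scale c (T (Poly_Mapping.single (u @ x # v) 1))"
  "T (Poly_Mapping.single (u @ x # y # v) 1)
    = T (Poly_Mapping.single (u @ y # x # v) 1) + T (Poly_Mapping.single (u @ bracket x y # v) 1)"
proof -
  have "Poly_Mapping.single (u @ (x + y) # v) 1 - Poly_Mapping.single (u @ x # v) 1
      - Poly_Mapping.single (u @ y # v) 1 \<in> env_relations"
    unfolding env_relations_def
    by (intro UnI1 CollectI exI[of _ u] exI[of _ v] exI[of _ x] exI[of _ y]) simp
  from T_relations_zero(1)[OF this]
  show "T (Poly_Mapping.single (u @ (x + y) # v) 1)
    = T (Poly_Mapping.single (u @ x # v) 1) + T (Poly_Mapping.single (u @ y # v) 1)"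
    by (simp add: T_diff T_add algebra_simps)
  have "Poly_Mapping.single (u @ heis_scale c x # v) 1 - Poly_Mapping.single (u @ x # v) c
      \<in> env_relations"
    unfolding env_relations_def
    by (intro UnI1 UnI2 CollectI exI[of _ u] exI[of _ v] exI[of _ c] exI[of _ x]) simp
  from T_relations_zero(1)[OF this]
  show "T (Poly_Mapping.single (u @ heis_scale c x # v) 1)
    = free_scale c (T (Poly_Mapping.single (u @ x # v) 1))"
    by (simp add: T_diff T_single[of _ c])
  have "Poly_Mapping.single (u @ x # y # v) 1 - Poly_Mapping.single (u @ y # x # v) 1
      - Poly_Mapping.single (u @ bracket x y # v) 1 \<in> env_relations"
    unfolding env_relations_def
    by (intro UnI2 CollectI exI[of _ u] exI[of _ v] exI[of _ x] exI[of _ y]) simp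
  from T_relations_zero(1)[OF this]
  show "T (Poly_Mapping.single (u @ x # y # v) 1)
    = T (Poly_Mapping.single (u @ y # x # v) 1) + T (Poly_Mapping.single (u @ bracket x y # v) 1)"
    by (simp add: T_diff T_add algebra_simps)
qed

lemma lie_act_add_left: "lie_act (x + y) p = lie_act x p + lie_act y p"
proof (induction p rule: free_induct)
  case (single w c)
  show ?case
    using T_env(1)[of "[]" x y w] by (simp add: lie_act_def T_single[of _ c] free.scale_right_distrib)
qed (simp_all add: lie_act_add algebra_simps)

lemma lie_act_scale_left: "lie_act (heis_scale c x) p = free_scale c (lie_act x p)"
proof (induction p rule: free_induct)
  case (single w d)
  show ?case
    using T_env(2)[of "[]" c x w] by (simp add: lie_act_def T_single[of _ d] mult.commute)
qed (simp_all add: lie_act_add free.scale_right_distrib)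

lemma lie_act_zero_left [simp]: "lie_act 0 p = 0"
  using lie_act_add_left[of 0 0 p] by simp

lemma lie_act_sum_left: "lie_act (sum x I) p = (\<Sum>i\<in>I. lie_act (x i) p)"
  by (induction I rule: infinite_finite_induct) (simp_all add: lie_act_add_left)

lemma lie_act_commute: "lie_act x (lie_act y (T p)) = lie_act y (lie_act x (T p)) + lie_act (bracket x y) (T p)"
  unfolding lie_act_T
proof (induction p rule: free_induct)
  case (single w c)
  show ?case
    using T_env(3)[of "[]" x y w] by (simp add: T_single[of _ c] free.scale_right_distrib)
qed (simp_all add: push_words_add T_add algebra_simps)

lemma T_relation:
  "T (Poly_Mapping.single (u @ [of_nonneg x]) 1) = free_scale (lam x) (T (Poly_Mapping.single u 1))"
  "T (Poly_Mapping.single (u @ [central]) 1) = T (Poly_Mapping.single u 1)"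
proof -
  have "Poly_Mapping.single (u @ [of_nonneg x]) 1 - Poly_Mapping.single u (lam x)
      \<in> whittaker_relations lam"
    "Poly_Mapping.single (u @ [central]) 1 - Poly_Mapping.single u 1 \<in> whittaker_relations lam"
    unfolding whittaker_relations_def by blast+
  from this[THEN T_relations_zero(2)]
  show "T (Poly_Mapping.single (u @ [of_nonneg x]) 1)
      = free_scale (lam x) (T (Poly_Mapping.single u 1))"
    "T (Poly_Mapping.single (u @ [central]) 1) = T (Poly_Mapping.single u 1)"
    by (simp_all add: T_diff T_single[of _ "lam x"])
qed

text \<open>
  The relation \<open>K w = w\<close> is imposed at the right end of a word, and \<open>K\<close> moves there because it is
  central.
\<close>

lemma lie_act_central: "lie_act central (T p) = T p"
proof (induction p rule: free_induct)
  case (single w c)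
  have "lie_act central (T (Poly_Mapping.single w 1)) = T (Poly_Mapping.single w 1)"
  proof (induction w)
    case Nil
    show ?case using T_relation(2)[of "[]"] by (simp add: lie_act_T)
  next
    case (Cons x w)
    have br: "bracket central x = 0" by (simp add: bracket_def central_def zero_prod_def)
    have "lie_act central (T (Poly_Mapping.single (x # w) 1))
        = lie_act central (lie_act x (T (Poly_Mapping.single w 1)))" by (simp add: lie_act_T)
    also have "\<dots> = lie_act x (lie_act central (T (Poly_Mapping.single w 1)))"
      by (subst lie_act_commute) (simp add: br)
    also have "\<dots> = T (Poly_Mapping.single (x # w) 1)" unfolding Cons by (simp add: lie_act_T)
    finally show ?case .
  qed
  then show ?case by (simp only: T_single[of w c] lie_act_scale)
qed (simp_all add: T_add lie_act_add)

definition mode_op :: "'h \<Rightarrow> int \<Rightarrow> 'h free_alg \<Rightarrow> 'h free_alg" where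
  "mode_op a k = lie_act (h_mode a k)"

definition vacuum :: "'h free_alg" where
  "vacuum = T (Poly_Mapping.single [] 1)"

sublocale whittaker_operators scale form free_scale "range T" mode_op vacuum
  "\<lambda>a n. lam (Poly_Mapping.single n a)" B
proof unfold_locales
  show "finite B" "independent B" "span B = UNIV" by (fact finite_basis)+
  show "mode_op a k (v + w) = mode_op a k v + mode_op a k w" for a k v w
    by (simp add: mode_op_def lie_act_add)
  show "mode_op a k (free_scale c v) = free_scale c (mode_op a k v)" for a k c v
    by (simp add: mode_op_def lie_act_scale)
  show "mode_op (a + b) k v = mode_op a k v + mode_op b k v" for a b k v
    by (simp add: mode_op_def h_mode_add lie_act_add_left)
  show "mode_op (scale c a) k v = free_scale c (mode_op a k v)" for c a k v
    by (simp add: mode_op_def h_mode_scale lie_act_scale_left)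
  show "lam (Poly_Mapping.single n (a + b))
      = lam (Poly_Mapping.single n a) + lam (Poly_Mapping.single n b)" for n a b
    by (simp add: single_add lam_add)
  show "lam (Poly_Mapping.single n (scale c a)) = c * lam (Poly_Mapping.single n a)" for n c a
    by (simp add: loop_scale_single[symmetric] lam_scale)
  show "\<exists>N. \<forall>n\<ge>N. lam (Poly_Mapping.single n a) = 0" for a
    using whittaker by (simp add: whittaker_function_def)
  show "free.subspace (range T)"
  proof (rule free.subspaceI)
    show "0 \<in> range T" by (rule image_eqI[of _ _ 0]) simp_all
    show "x + y \<in> range T" if "x \<in> range T" "y \<in> range T" for x y
      using that by (elim imageE) (simp flip: T_add)
    show "free_scale c x \<in> range T" if "x \<in> range T" for c x
      using that by (elim imageE) (simp flip: T_scale)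
  qed
  show "mode_op a k v \<in> range T" for a k v
    by (simp add: mode_op_def lie_act_def)
  show "mode_op a j (mode_op b k v) = mode_op b k (mode_op a j v)
      + free_scale (if j + k = 0 then of_int j * form a b else 0) v" if v: "v \<in> range T"
    for v a j b k
  proof -
    from v obtain p where p: "v = T p" by (rule imageE)
    show ?thesis
      unfolding mode_op_def p lie_act_commute[of "h_mode a j"] bracket_h_mode lie_act_scale_left lie_act_central ..
  qed
  show "vacuum \<in> range T" by (simp add: vacuum_def)
  show "mode_op a (int n) vacuum = free_scale (lam (Poly_Mapping.single n a)) vacuum" for a n
    using T_relation(1)[of "[]" "Poly_Mapping.single n a"]
    by (simp add: mode_op_def vacuum_def lie_act_T h_mode_nonneg)
  show "range T \<subseteq> S" if S: "free.subspace S" "vacuum \<in> S"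
    and act: "\<And>a k v. v \<in> S \<Longrightarrow> v \<in> range T \<Longrightarrow> mode_op a k v \<in> S" for S
  proof -
    have lie_act_S: "lie_act x (T p) \<in> S" if "T p \<in> S" for x p
    proof -
      have "lie_act x (T p) = lie_act ((\<Sum>k\<in>Poly_Mapping.keys (fst x). h_mode (Poly_Mapping.lookup (fst x) k) k)
          + heis_scale (snd x) central) (T p)"
        by (simp only: heis_decomposition[symmetric])
      also have "\<dots> = (\<Sum>k\<in>Poly_Mapping.keys (fst x). mode_op (Poly_Mapping.lookup (fst x) k) k (T p))
          + free_scale (snd x) (T p)"
        by (simp only: lie_act_add_left lie_act_sum_left lie_act_scale_left lie_act_central mode_op_def)
      also have "\<dots> \<in> S"
        using S(1) that by (intro free.subspace_add free.subspace_sum free.subspace_scale act) simp_all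
      finally show ?thesis .
    qed
    have word: "T (Poly_Mapping.single w 1) \<in> S" for w
    proof (induction w)
      case Nil
      show ?case using S(2) by (simp add: vacuum_def)
    next
      case (Cons x w)
      then show ?case using lie_act_S[OF Cons, of x] by (simp add: lie_act_T)
    qed
    have "T p \<in> S" for p
    proof (induction p rule: free_induct)
      case (single w c)
      show ?case unfolding T_single[of w c] using S(1) word by (simp add: free.subspace_scale)
    qed (use S(1) in \<open>simp_all add: T_add free.subspace_0 free.subspace_add\<close>)
    then show ?thesis by (rule image_subsetI)
  qed
qed

subsection \<open>Cosets\<close>

definition val :: "'h free_alg set \<Rightarrow> 'h free_alg" where
  "val X = T (rep X)"

lemma val_cls [simp]: "val (cls lam p) = T p"
  unfolding val_def T_eq_iff by (rule rep_cls)

lemma val_range: "val X \<in> range T"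
  by (simp add: val_def)

lemma val_eqD:
  assumes "X \<in> whittaker_module lam" "Y \<in> whittaker_module lam" "val X = val Y"
  shows "X = Y"
proof -
  obtain p q where pq: "X = cls lam p" "Y = cls lam q"
    using assms(1,2) unfolding whittaker_module_def by blast
  then have "T p = T q" using assms(3) by simp
  then show ?thesis unfolding pq by (simp only: T_eq_iff cls_eq_iff)
qed

lemma val_wzero [simp]: "val (wzero lam) = 0"
  by (simp add: wzero_def)

lemma val_wadd: "val (wadd lam X Y) = val X + val Y"
  by (simp add: wadd_def T_add) (simp add: val_def)

lemma val_wscale: "val (wscale lam c X) = free_scale c (val X)"
  by (simp add: wscale_def T_scale) (simp add: val_def)

lemma val_wact: "val (wact lam (h_mode a k) X) = mode_op a k (val X)"
  by (simp add: wact_def) (simp add: val_def mode_op_def lie_act_T)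

lemma in_whittaker_module [simp]:
  "cls lam p \<in> whittaker_module lam" "wzero lam \<in> whittaker_module lam"
  "wadd lam X Y \<in> whittaker_module lam" "wscale lam c X \<in> whittaker_module lam"
  "wact lam x X \<in> whittaker_module lam" "wsum lam Z \<in> whittaker_module lam"
  by (simp_all add: whittaker_module_def wzero_def wadd_def wscale_def wact_def wsum_def)

text \<open>
  The sum \<open>wsum\<close> runs over the indices with a nonzero class. By injectivity of \<open>val\<close> these are the
  indices with a nonzero normal form.
\<close>

lemma val_wsum:
  assumes "\<And>i. X i \<in> whittaker_module lam" "finite I" "{i. val (X i) \<noteq> 0} \<subseteq> I"
  shows "val (wsum lam X) = (\<Sum>i\<in>I. val (X i))"
proof -
  have "X i \<noteq> wzero lam \<longleftrightarrow> val (X i) \<noteq> 0" for i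
    using val_eqD[OF assms(1)[of i], of "wzero lam"] by auto
  then have "val (wsum lam X) = (\<Sum>i | val (X i) \<noteq> 0. val (X i))"
    by (simp add: wsum_def T_sum) (simp add: val_def)
  also have "\<dots> = (\<Sum>i\<in>I. val (X i))"
    using assms by (intro sum.mono_neutral_left) auto
  finally show ?thesis .
qed

lemma normal_mode_in [simp]:
  "X \<in> whittaker_module lam \<Longrightarrow> normal_mode lam w m X \<in> whittaker_module lam"
  by (cases w) (auto split: prod.splits)

lemma val_normal_mode:
  assumes "X \<in> whittaker_module lam" "1 \<le> N" "\<forall>a. \<forall>k\<ge>int N. mode_op a k (val X) = 0"
  shows "val (normal_mode lam w m X) = mode N w m (val X)"
  using assms
proof (induction w arbitrary: m X)
  case Nil
  then show ?case by (simp add: mode_Nil)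
next
  case (Cons p w)
  obtain a n where p: "p = (a, n)" by force
  define Z where "Z k = wscale lam (of_int (- k - 1) gchoose n)
       (if k < 0
        then wact lam (h_mode a k) (normal_mode lam w (m - k - int n - 1) X)
        else normal_mode lam w (m - k - int n - 1) (wact lam (h_mode a k) X))" for k :: int
  have Z: "val (Z k) = mode_term N a n w m (val X) k" for k
  proof (cases "k < 0")
    case True
    then show ?thesis
      using Cons.IH[OF Cons.prems] by (simp add: Z_def mode_term_def mode_coeff_def val_wscale val_wact)
  next
    case False
    have "val (normal_mode lam w (m - k - int n - 1) (wact lam (h_mode a k) X))
        = mode N w (m - k - int n - 1) (val (wact lam (h_mode a k) X))"
      using A_bounded_step[OF val_range Cons.prems(3,2), of k a] False Cons.prems(2)
      by (intro Cons.IH) (simp_all add: val_wact)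
    then show ?thesis
      using False by (simp add: Z_def mode_term_def mode_coeff_def val_wscale val_wact)
  qed
  obtain I where I: "finite I" "{k. mode_term N a n w m (val X) k \<noteq> 0} \<subseteq> I"
    "mode N ((a, n) # w) m (val X) = (\<Sum>k\<in>I. mode_term N a n w m (val X) k)"
    by (rule mode_Cons[OF Cons.prems(3)])
  have "normal_mode lam (p # w) m X = wsum lam Z"
    by (simp add: p Z_def[abs_def])
  also have "val \<dots> = (\<Sum>k\<in>I. val (Z k))"
    using I(1,2) by (intro val_wsum) (simp_all only: Z, simp add: Z_def)
  finally show ?case by (simp add: Z I(3) p)
qed

text \<open>
  The definition of \<open>vertex_mode\<close> picks some combination of monomials representing the state. Since
  modes are symmetric and multilinear in the factors, any other representative \<open>q\<close> gives the same
  operator.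
\<close>

lemma val_vertex_mode:
  assumes X: "X \<in> whittaker_module lam" and N: "1 \<le> N" "\<forall>a. \<forall>k\<ge>int N. mode_op a k (val X) = 0"
  shows "val (vertex_mode lam (cls zero_function (creation q)) m X)
    = linear_extension free_scale (\<lambda>w. mode N w m (val X)) q"
proof -
  define p where "p = (SOME p. cls zero_function (creation p) = cls zero_function (creation q))"
  have "cls zero_function (creation p) = cls zero_function (creation q)"
    unfolding p_def by (rule someI) (rule refl)
  then have eq: "creation p - creation q \<in> whittaker_kernel zero_function"
    by (simp only: cls_eq_iff)
  define Z where "Z w = wscale lam (Poly_Mapping.lookup p w) (normal_mode lam w m X)" for w
  have Z: "val (Z w) = free_scale (Poly_Mapping.lookup p w) (mode N w m (val X))" for w
    by (simp add: Z_def val_wscale val_normal_mode[OF X N])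
  have "vertex_mode lam (cls zero_function (creation q)) m X = wsum lam Z"
    by (simp add: vertex_mode_def p_def Z_def[abs_def] Let_def)
  also have "val \<dots> = (\<Sum>w\<in>Poly_Mapping.keys p. val (Z w))"
    by (rule val_wsum) (simp add: Z_def, simp, auto simp: Z in_keys_iff)
  also have "\<dots> = linear_extension free_scale (\<lambda>w. mode N w m (val X)) p"
    by (simp add: Z linear_extension_def)
  also have "\<dots> = linear_extension free_scale (\<lambda>w. mode N w m (val X)) q"
  proof -
    have sf: "symmetric_functionals scale form free_scale zero_function"
      by unfold_locales simp_all
    have "symmetric_functionals.sym_multilinear scale free_scale (\<lambda>w. mode N w m (val X))"
      unfolding symmetric_functionals.sym_multilinear_def[OF sf]
      using mode_swap[OF val_range] by (simp add: mode_add_entry mode_scale_entry)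
    from symmetric_functionals.creation_determines_functionals[OF sf this eq] show ?thesis .
  qed
  finally show ?thesis .
qed

end

section \<open>Fixed points and irreducibility\<close>

definition heis_map :: "('h \<Rightarrow> 'h) \<Rightarrow> 'h::zero heis \<Rightarrow> 'h heis" where
  "heis_map g = (\<lambda>(x, c). (Poly_Mapping.map g x, c))"

context heisenberg_space
begin

lemma orthogonal_groupD:
  assumes "g \<in> carrier orthogonal_group"
  shows "g (x + y) = g x + g y" "g (scale c x) = scale c (g x)" "form (g x) (g y) = form x y"
    "g 0 = 0" "bij g" "g x = 0 \<longleftrightarrow> x = 0"
proof -
  have lin: "Vector_Spaces.linear scale scale g" and bij: "bij g"
    and "\<forall>x y. form (g x) (g y) = form x y"
    using assms by (simp_all add: orthogonal_group_def)
  then show "g (x + y) = g x + g y" "g (scale c x) = scale c (g x)"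
    "form (g x) (g y) = form x y" "bij g"
    by (simp_all add: Vector_Spaces.linear_iff)
  show zero: "g 0 = 0"
    using lin scale_zero_left[of 0] unfolding Vector_Spaces.linear_iff by (metis scale_zero_left)
  show "g x = 0 \<longleftrightarrow> x = 0"
    using bij zero by (metis bij_pointE)
qed

context
  fixes g :: "'h \<Rightarrow> 'h"
  assumes g: "g \<in> carrier orthogonal_group"
begin

lemma lookup_map_orthogonal [simp]:
  fixes x :: "'k \<Rightarrow>\<^sub>0 'h"
  shows "Poly_Mapping.lookup (Poly_Mapping.map g x) k = g (Poly_Mapping.lookup x k)"
  by (simp add: Poly_Mapping.map.rep_eq when_def orthogonal_groupD(4)[OF g])

lemma heis_map_add: "heis_map g (x + y) = heis_map g x + heis_map g y"
  by (cases x; cases y)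
     (auto simp: heis_map_def lookup_add orthogonal_groupD(1)[OF g] intro!: poly_mapping_eqI)

lemma heis_map_scale: "heis_map g (heis_scale c x) = heis_scale c (heis_map g x)"
  by (cases x)
     (auto simp: heis_map_def heis_scale_def orthogonal_groupD(2)[OF g] Poly_Mapping.map.rep_eq
        loop_scale_def when_def orthogonal_groupD(4)[OF g] intro!: poly_mapping_eqI)

lemma map_orthogonal_zero: "Poly_Mapping.map g (0 :: 'k \<Rightarrow>\<^sub>0 'h) = 0"
  by (rule poly_mapping_eqI) (simp add: orthogonal_groupD(4)[OF g])

lemma keys_map_orthogonal: "Poly_Mapping.keys (Poly_Mapping.map g x) = Poly_Mapping.keys x"
  for x :: "'k \<Rightarrow>\<^sub>0 'h"
  by (auto simp: in_keys_iff orthogonal_groupD(6)[OF g])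

lemma heis_map_bracket: "bracket (heis_map g x) (heis_map g y) = heis_map g (bracket x y)"
  by (cases x; cases y)
     (simp add: heis_map_def bracket_def map_orthogonal_zero keys_map_orthogonal
        orthogonal_groupD(3)[OF g])

lemma heis_map_of_nonneg: "heis_map g (of_nonneg x) = of_nonneg (Poly_Mapping.map g x)"
proof -
  have "Poly_Mapping.lookup (fst (heis_map g (of_nonneg x))) k
      = Poly_Mapping.lookup (fst (of_nonneg (Poly_Mapping.map g x))) k" for k
    using lookup_of_nonneg[of x k] lookup_of_nonneg[of "Poly_Mapping.map g x" k]
    by (simp add: heis_map_def case_prod_beta orthogonal_groupD(4)[OF g])
  then have "fst (heis_map g (of_nonneg x)) = fst (of_nonneg (Poly_Mapping.map g x))"
    by (rule poly_mapping_eqI)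
  then show ?thesis by (simp add: prod_eq_iff) (simp add: heis_map_def of_nonneg_def)
qed

lemma heis_map_central: "heis_map g central = central"
  by (simp add: heis_map_def central_def map_orthogonal_zero)

lemma heis_map_h_mode: "heis_map g (h_mode a k) = h_mode (g a) k"
  by (simp add: heis_map_def h_mode_def)
     (rule poly_mapping_eqI, simp add: lookup_single when_def orthogonal_groupD(4)[OF g])

lemma push_words_heis_map_kernel:
  assumes "p \<in> whittaker_kernel zero_function"
  shows "push_words (map (heis_map g)) p \<in> whittaker_kernel zero_function"
proof (rule push_words_kernel[OF _ assms])
  fix r assume "r \<in> env_relations \<union> whittaker_relations zero_function"
  then show "push_words (map (heis_map g)) r \<in> whittaker_kernel zero_function"
  proof
    assume "r \<in> env_relations"
    then have "push_words (map (heis_map g)) r \<in> env_relations"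
      unfolding env_relations_def
    proof (elim UnE CollectE exE conjE, goal_cases)
      case (1 u v y z)
      then show ?case
        by (intro UnI1 CollectI exI[of _ "map (heis_map g) u"] exI[of _ "map (heis_map g) v"]
            exI[of _ "heis_map g y"] exI[of _ "heis_map g z"])
           (simp add: push_words_diff heis_map_add)
    next
      case (2 u v c y)
      then show ?case
        by (intro UnI1 UnI2 CollectI exI[of _ "map (heis_map g) u"] exI[of _ "map (heis_map g) v"]
            exI[of _ "heis_map g y"] exI[of _ c])
           (simp add: push_words_diff heis_map_scale)
    next
      case (3 u v y z)
      then show ?case
        by (intro UnI2 CollectI exI[of _ "map (heis_map g) u"] exI[of _ "map (heis_map g) v"]
            exI[of _ "heis_map g y"] exI[of _ "heis_map g z"])
           (simp add: push_words_diff heis_map_bracket)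
    qed
    then show ?thesis by (rule env_relation_in_kernel)
  next
    assume "r \<in> whittaker_relations zero_function"
    then have "push_words (map (heis_map g)) r \<in> whittaker_relations zero_function"
      unfolding whittaker_relations_def
    proof (elim UnE CollectE exE conjE, goal_cases)
      case (1 u y)
      then show ?case
        by (intro UnI1 CollectI exI[of _ "map (heis_map g) u"] exI[of _ "Poly_Mapping.map g y"])
           (simp add: push_words_diff heis_map_of_nonneg)
    next
      case (2 u)
      then show ?case
        by (intro UnI2 CollectI exI[of _ "map (heis_map g) u"])
           (simp add: push_words_diff heis_map_central)
    qed
    then show ?thesis by (rule whittaker_relation_in_kernel)
  qed
qed

lemma voa_act_cls:
  "voa_act g (cls zero_function p) = cls zero_function (push_words (map (heis_map g)) p)"
  unfolding voa_act_def heis_map_def[symmetric] cls_eq_iff push_words_diff[symmetric]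
  by (rule push_words_heis_map_kernel[OF rep_cls])

lemma push_words_creation:
  "push_words (map (heis_map g)) (creation q) = creation (push_words (map (map_prod g id)) q)"
proof (induction q rule: free_induct)
  case (single w c)
  have "map (heis_map g) (map (\<lambda>(a, n). h_mode a (- int n - 1)) w)
      = map (\<lambda>(a, n). h_mode a (- int n - 1)) (map (map_prod g id) w)"
    by (induction w) (auto simp: heis_map_h_mode)
  then show ?case by (simp only: creation_def push_words_single)
qed (simp_all add: creation_def push_words_add)

end

text \<open>
  Left translation by an element of \<open>G\<close> permutes the summands.
\<close>

lemma averaged_word_fixed:
  assumes G: "subgroup G orthogonal_group" "finite G"
  shows "cls zero_function (creation (\<Sum>g\<in>G. Poly_Mapping.single (map (map_prod g id) w) 1))
    \<in> voa_fixed_points G"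
proof -
  let ?q = "\<Sum>g\<in>G. Poly_Mapping.single (map (map_prod g id) w) (1 :: complex)"
  have "voa_act h (cls zero_function (creation ?q)) = cls zero_function (creation ?q)"
    if h: "h \<in> G" for h
  proof -
    have hc: "h \<in> carrier orthogonal_group" using subgroup.subset[OF G(1)] h by blast
    have closed: "h \<circ> g \<in> G" if "g \<in> G" for g
      using subgroup.m_closed[OF G(1) h that] by (simp add: orthogonal_group_def)
    have inj: "inj_on ((\<circ>) h) G"
    proof (rule inj_onI)
      fix f g assume "h \<circ> f = h \<circ> g"
      then show "f = g"
        using bij_is_inj[OF orthogonal_groupD(5)[OF hc]] by (simp add: fun_eq_iff inj_eq)
    qed
    have img: "(\<circ>) h ` G = G"
      using closed by (intro endo_inj_surj[OF G(2)] inj) auto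
    have "push_words (map (map_prod h id)) ?q
        = (\<Sum>g\<in>G. Poly_Mapping.single (map (map_prod (h \<circ> g) id) w) 1)"
      by (simp add: push_words_sum map_prod_compose[symmetric] comp_def[of "map_prod h id"])
    also have "\<dots> = (\<Sum>g\<in>(\<circ>) h ` G. Poly_Mapping.single (map (map_prod g id) w) 1)"
      by (simp add: sum.reindex[OF inj])
    finally show ?thesis
      by (simp add: voa_act_cls[OF hc] push_words_creation[OF hc] img)
  qed
  then show ?thesis
    by (simp add: voa_fixed_points_def heisenberg_voa_def whittaker_module_def)
qed

text \<open>
  A Whittaker function is determined by its values on the elements \<open>a(n)\<close>.
\<close>

lemma whittaker_function_twist:
  assumes lam: "whittaker_function lam" and g: "g \<in> carrier orthogonal_group"
    and neq: "function_act g lam \<noteq> lam"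
  shows "\<exists>a n. lam (Poly_Mapping.single n (g a)) \<noteq> lam (Poly_Mapping.single n a)"
proof (rule ccontr)
  assume "\<not> ?thesis"
  then have inv: "lam (Poly_Mapping.single n (g a)) = lam (Poly_Mapping.single n a)" for a n by blast
  have lam_add: "lam (x + y) = lam x + lam y" for x y
    using lam unfolding whittaker_function_def by (simp add: Vector_Spaces.linear_iff)
  have lam_zero: "lam 0 = 0" using lam_add[of 0 0] by simp
  have lam_sum: "lam (sum f I) = (\<Sum>i\<in>I. lam (f i))" for f :: "nat \<Rightarrow> _" and I
    by (induction I rule: infinite_finite_induct) (simp_all add: lam_add lam_zero)
  define h where "h = inv_into UNIV g"
  have gh: "g (h a) = a" for a
    unfolding h_def by (rule surj_f_inv_f) (rule bij_is_surj[OF orthogonal_groupD(5)[OF g]])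
  have h0: "h 0 = 0"
    unfolding h_def using orthogonal_groupD(4,5)[OF g] by (metis bij_is_inj inv_f_f)
  have single: "(\<Sum>k\<in>Poly_Mapping.keys x. Poly_Mapping.single k (Poly_Mapping.lookup x k)) = x"
    for x :: "nat \<Rightarrow>\<^sub>0 'h"
    by (rule poly_mapping_eqI) (simp add: lookup_sum lookup_single when_def in_keys_iff)
  have "function_act g lam x = lam x" for x
  proof -
    have "Poly_Mapping.map h x
        = (\<Sum>k\<in>Poly_Mapping.keys x. Poly_Mapping.single k (h (Poly_Mapping.lookup x k)))"
      by (rule poly_mapping_eqI)
         (auto simp: lookup_sum lookup_single when_def in_keys_iff Poly_Mapping.map.rep_eq h0)
    then have "function_act g lam x
        = (\<Sum>k\<in>Poly_Mapping.keys x. lam (Poly_Mapping.single k (h (Poly_Mapping.lookup x k))))"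
      by (simp add: function_act_def h_def[symmetric] lam_sum)
    also have "\<dots> = (\<Sum>k\<in>Poly_Mapping.keys x. lam (Poly_Mapping.single k (Poly_Mapping.lookup x k)))"
      by (intro sum.cong refl) (metis inv gh)
    also have "\<dots> = lam x" unfolding lam_sum[symmetric] single ..
    finally show ?thesis .
  qed
  then show False using neq by blast
qed

end

context whittaker_setting
begin

text \<open>
  A submodule \<open>S\<close> contains, with any vector, its images under the modes of the averaged monomials. In
  terms of normal forms these are the sums over \<open>G\<close> of twisted modes.
\<close>

theorem orbifold_irreducible:
  assumes G: "subgroup G orthogonal_group" "finite G"
    and free: "\<And>g. g \<in> G \<Longrightarrow> g \<noteq> id \<Longrightarrow> function_act g lam \<noteq> lam"
  shows "irreducible_whittaker_module (voa_fixed_points G) lam"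
  unfolding irreducible_whittaker_module_def
proof (intro conjI allI impI)
  have "cls lam (Poly_Mapping.single [] 1) \<noteq> wzero lam"
    using vacuum_not_in_kernel[OF lam_add lam_scale] by (simp add: wzero_def cls_eq_iff)
  then show "whittaker_module lam \<noteq> {wzero lam}"
    using in_whittaker_module(1) by blast
next
  fix S assume "wsubspace lam S \<and> (\<forall>v\<in>voa_fixed_points G. \<forall>m. \<forall>X\<in>S. vertex_mode lam v m X \<in> S)"
  then have S: "S \<subseteq> whittaker_module lam" "wzero lam \<in> S"
    "\<And>X Y. X \<in> S \<Longrightarrow> Y \<in> S \<Longrightarrow> wadd lam X Y \<in> S" "\<And>c X. X \<in> S \<Longrightarrow> wscale lam c X \<in> S"
    and modes: "\<And>v m X. v \<in> voa_fixed_points G \<Longrightarrow> X \<in> S \<Longrightarrow> vertex_mode lam v m X \<in> S"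
    unfolding wsubspace_def by blast+
  show "S = {wzero lam} \<or> S = whittaker_module lam"
  proof (cases "S = {wzero lam}")
    case False
    then obtain X where X: "X \<in> S" "X \<noteq> wzero lam" using S(2) by blast
    have XM: "X \<in> whittaker_module lam" using X S(1) by blast
    have nz: "val X \<noteq> 0" using val_eqD[OF XM in_whittaker_module(2)] X(2) by auto
    obtain N where N: "1 \<le> N" "\<forall>a. \<forall>k\<ge>int N. mode_op a k (val X) = 0"
      using A_bounded[OF val_range[of X]] by blast
    have "range T \<subseteq> val ` S"
    proof (rule twisted_modes_generate[OF G(2) _ _ _ val_range nz N])
      show "id \<in> G"
        using subgroup.one_closed[OF G(1)] by (simp add: orthogonal_group_def)
      show "form (g a) (g b) = form a b" if "g \<in> G" for g a b
        using subgroup.subset[OF G(1)] that orthogonal_groupD(3) by blast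
      show "\<exists>a n. lam (Poly_Mapping.single n (g a)) \<noteq> lam (Poly_Mapping.single n a)"
        if "g \<in> G" "g \<noteq> id" for g
        using subgroup.subset[OF G(1)] that free whittaker by (intro whittaker_function_twist) auto
      show "free.subspace (val ` S)"
      proof (rule free.subspaceI)
        show "0 \<in> val ` S" by (rule image_eqI[OF _ S(2)]) simp
        fix x y assume "x \<in> val ` S" "y \<in> val ` S"
        then obtain Y Z where "x = val Y" "Y \<in> S" "y = val Z" "Z \<in> S" by blast
        then show "x + y \<in> val ` S" using S(3) by (intro image_eqI[of _ _ "wadd lam Y Z"]) (simp_all add: val_wadd)
      next
        fix c x assume "x \<in> val ` S"
        then obtain Y where "x = val Y" "Y \<in> S" by blast
        then show "free_scale c x \<in> val ` S"
          using S(4) by (intro image_eqI[of _ _ "wscale lam c Y"]) (simp_all add: val_wscale)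
      qed
      fix w :: "('h \<times> nat) list" and m
      define q where "q = (\<Sum>g\<in>G. Poly_Mapping.single (map (map_prod g id) w) (1 :: complex))"
      have "vertex_mode lam (cls zero_function (creation q)) m X \<in> S"
        unfolding q_def by (rule modes[OF averaged_word_fixed[OF G] X(1)])
      moreover have "val (vertex_mode lam (cls zero_function (creation q)) m X)
          = (\<Sum>g\<in>G. mode N (map (map_prod g id) w) m (val X))"
        unfolding val_vertex_mode[OF XM N] q_def linear_extension_sum[OF free.vector_space_axioms]
          linear_extension_single[OF free.vector_space_axioms] by simp
      ultimately show "(\<Sum>g\<in>G. mode N (map (map_prod g id) w) m (val X)) \<in> val ` S"
        by (metis imageI)
    qed
    have "Y \<in> S" if "Y \<in> whittaker_module lam" for Y
    proof -
      have "val Y \<in> val ` S" using \<open>range T \<subseteq> val ` S\<close> val_range by blast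
      then obtain Z where "val Y = val Z" "Z \<in> S" by blast
      then show ?thesis using val_eqD[OF that, of Z] S(1) by auto
    qed
    then show ?thesis using S(1) by blast
  qed simp
qed

end

lemma (in vector_space) finite_basis_if_dim_pos:
  assumes "dim UNIV \<ge> 1"
  obtains B where "finite B" "independent B" "span B = UNIV"
proof -
  obtain B where B: "independent B" "UNIV \<subseteq> span B" "card B = dim UNIV"
    using basis_exists[of UNIV] by blast
  then have "finite B" using assms by (intro card_ge_0_finite) simp
  then show thesis using that B by blast
qed

theorem theorem7p1:
  fixes scale :: "complex \<Rightarrow> 'h::ab_group_add \<Rightarrow> 'h"
    and form :: "'h \<Rightarrow> 'h \<Rightarrow> complex"
    and l :: nat
    and lam :: "(nat \<Rightarrow>\<^sub>0 'h) \<Rightarrow> complex"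
    and G :: "('h \<Rightarrow> 'h) set"
  assumes "heisenberg_space scale form"
    and "vector_space.dim scale (UNIV :: 'h set) = l" and "l \<ge> 1"
    and "heisenberg_space.whittaker_function scale lam"
    and "subgroup G (heisenberg_space.orthogonal_group scale form)" and "finite G"
    and "\<And>g. g \<in> G \<Longrightarrow> g \<noteq> id \<Longrightarrow> function_act g lam \<noteq> lam"
  shows "heisenberg_space.irreducible_whittaker_module scale form
           (heisenberg_space.voa_fixed_points scale form G) lam"
proof -
  interpret heisenberg_space scale form by fact
  obtain B where B: "finite B" "independent B" "span B = UNIV"
    using assms(2,3) finite_basis_if_dim_pos by metis
  obtain T where "\<forall>p q. T (p + q) = T p + T q" "\<forall>c p. T (free_scale c p) = free_scale c (T p)"
    "\<forall>p. T p = 0 \<longleftrightarrow> p \<in> whittaker_kernel lam" "\<forall>p. T (T p) = T p"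
    by (rule free.projection_with_kernel[OF kernel_subspace[of lam]])
  then have "whittaker_setting scale form lam B T"
    by unfold_locales (simp_all add: B assms(4))
  then show ?thesis
    using assms(5-7) by (rule whittaker_setting.orbifold_irreducible)
qed

end
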